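(* Let $\mathcal A$ be a finite-dimensional $C^*$-algebra over $\mathbb F\in\{\mathbb R,\mathbb C\}$. Then $\mathcal A$ is a pseudo-abelian $C^*$-algebra if and only if $\mathcal L_{\mathcal A}^{\bot\bot}=\mathcal A$.
   Context: For vectors $v,w$ in a normed space $V$ over $\mathbb F$, $v\perp w$ (Birkhoff–James orthogonality) means $\|v\|\le\|v+\lambda w\|$ for all $\lambda\in\mathbb F$. Put $v^\bot=\{w\in V: v\perp w\}$ and ${}^\bot v=\{w\in V: w\perp v\}$. A vector $v$ is left-symmetric if $v^\bot\subseteq{}^\bot v$. $\mathcal L_{\mathcal A}$ is the set of all left-symmetric elements of $\mathcal A$, $\mathcal L_{\mathcal A}^{\bot}:=\bigcap_{v\in\mathcal L_{\mathcal A}}v^\bot$ and $\mathcal L_{\mathcal A}^{\bot\bot}:=\bigcap_{v\in\mathcal L_{\mathcal A}^{\bot}}v^\bot$. $C^*$-algebras may be real or complex. A finite-dimensional $C^*$-algebra over $\mathbb F$ is $*$-isomorphic to $\bigoplus_{k=1}^\ell\mathcal M_{n_k}(\mathbb K_k)$ with all $\mathbb K_k=\mathbb C$ if $\mathbb F=\mathbb C$ and $\mathbb K_k\in\{\mathbb R,\mathbb C,\mathbb H\}$ if $\mathbb F=\mathbb R$ (involution is conjugate transpose, norm is the maximum of the operator norms of the blocks). It is pseudo-abelian if it is the sum of those of its minimal two-sided ideals that are skew-fields, equivalently if all blocks in this decomposition have size one. *)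

theory Defs
  imports Complex_Main
begin

text \<open>
  The scalar field is a type \<open>'f\<close>, later only \<open>real\<close> or \<open>complex\<close>; \<open>scale\<close> is the scalar
  multiplication and \<open>conj\<close> the conjugation of \<open>'f\<close>. A normed space over \<open>'f\<close> lives on a type of
  class \<open>real_normed_vector\<close>, whose real scalar multiplication is required to be the restriction
  of \<open>scale\<close>.
\<close>

definition bj_orthogonal :: "('f \<Rightarrow> 'v \<Rightarrow> 'v) \<Rightarrow> 'v::real_normed_vector \<Rightarrow> 'v \<Rightarrow> bool"
  where "bj_orthogonal scale v w \<longleftrightarrow> (\<forall>c. norm v \<le> norm (v + scale c w))"

definition right_perp :: "('f \<Rightarrow> 'v \<Rightarrow> 'v) \<Rightarrow> 'v::real_normed_vector \<Rightarrow> 'v set"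
  where "right_perp scale v = {w. bj_orthogonal scale v w}"

definition left_perp :: "('f \<Rightarrow> 'v \<Rightarrow> 'v) \<Rightarrow> 'v::real_normed_vector \<Rightarrow> 'v set"
  where "left_perp scale v = {w. bj_orthogonal scale w v}"

definition left_symmetric :: "('f \<Rightarrow> 'v \<Rightarrow> 'v) \<Rightarrow> 'v::real_normed_vector \<Rightarrow> bool"
  where "left_symmetric scale v \<longleftrightarrow> right_perp scale v \<subseteq> left_perp scale v"

definition left_symmetric_set :: "('f \<Rightarrow> 'v \<Rightarrow> 'v) \<Rightarrow> 'v::real_normed_vector set"
  where "left_symmetric_set scale = {v. left_symmetric scale v}"

definition set_perp :: "('f \<Rightarrow> 'v \<Rightarrow> 'v) \<Rightarrow> 'v::real_normed_vector set \<Rightarrow> 'v set"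
  where "set_perp scale S = (\<Inter>v\<in>S. right_perp scale v)"

locale normed_algebra_over = vector_space scale
  for scale :: "'f::real_normed_field \<Rightarrow> 'a::{real_normed_algebra,banach} \<Rightarrow> 'a" +
  assumes scale_of_real: "scale (of_real r) x = r *\<^sub>R x"
    and norm_scale: "norm (scale c x) = norm c * norm x"
    and mult_scale_left: "scale c x * y = scale c (x * y)"
    and mult_scale_right: "x * scale c y = scale c (x * y)"

locale cstar_algebra = normed_algebra_over scale
  for conj :: "'f::real_normed_field \<Rightarrow> 'f"
    and scale :: "'f \<Rightarrow> 'a::{real_normed_algebra,banach} \<Rightarrow> 'a"
    and star :: "'a \<Rightarrow> 'a" +
  assumes star_star: "star (star x) = x"
    and star_add: "star (x + y) = star x + star y"
    and star_scale: "star (scale c x) = scale (conj c) (star x)"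
    and star_mult: "star (x * y) = star y * star x"
    and cstar_identity: "norm (star x * x) = (norm x)\<^sup>2"

locale complex_cstar_algebra = cstar_algebra cnj scale star
  for scale :: "complex \<Rightarrow> 'a::{real_normed_algebra,banach} \<Rightarrow> 'a"
    and star :: "'a \<Rightarrow> 'a"

text \<open>
  Over the reals the C*-identity alone is too weak (it holds in the real algebra \<open>\<complex>\<close> with the
  identity as involution), and one requires in addition that \<open>1 + x\<^sup>*x\<close> is invertible in the
  unitization. No unit is assumed here: an inverse necessarily has the form \<open>1 + y\<close> with \<open>y\<close> in
  the algebra, and the axiom below spells out \<open>(1 + x\<^sup>*x)(1 + y) = 1 = (1 + y)(1 + x\<^sup>*x)\<close>.
\<close>

locale real_cstar_algebra = cstar_algebra "\<lambda>r. r" scaleR star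
  for star :: "'a::{real_normed_algebra,banach} \<Rightarrow> 'a" +
  assumes one_plus_star_mult_invertible:
    "\<exists>y. star x * x + y + star x * x * y = 0 \<and> star x * x + y + y * (star x * x) = 0"

definition finite_dim :: "('f::field \<Rightarrow> 'v::ab_group_add \<Rightarrow> 'v) \<Rightarrow> bool"
  where "finite_dim scale \<longleftrightarrow> (\<exists>B. finite B \<and> module.span scale B = UNIV)"

definition two_sided_ideal ::
    "('f::field \<Rightarrow> 'a \<Rightarrow> 'a) \<Rightarrow> 'a::ring set \<Rightarrow> bool"
  where "two_sided_ideal scale I \<longleftrightarrow>
    module.subspace scale I \<and> (\<forall>x\<in>I. \<forall>a. a * x \<in> I \<and> x * a \<in> I)"

definition minimal_ideal ::
    "('f::field \<Rightarrow> 'a \<Rightarrow> 'a) \<Rightarrow> 'a::ring set \<Rightarrow> bool"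
  where "minimal_ideal scale I \<longleftrightarrow>
    two_sided_ideal scale I \<and> I \<noteq> {0} \<and>
    (\<forall>J. two_sided_ideal scale J \<and> J \<subseteq> I \<longrightarrow> J = {0} \<or> J = I)"

text \<open>
  \<open>I\<close> is a skew-field under the operations of the ambient ring; its identity \<open>e\<close> need not be an
  identity of the ambient ring.
\<close>

definition is_skew_field :: "'a::ring set \<Rightarrow> bool"
  where "is_skew_field I \<longleftrightarrow>
    (\<exists>e\<in>I. e \<noteq> 0 \<and> (\<forall>x\<in>I. e * x = x \<and> x * e = x) \<and>
      (\<forall>x\<in>I. x \<noteq> 0 \<longrightarrow> (\<exists>y\<in>I. x * y = e \<and> y * x = e)))"

text \<open>
  The sum of a family of ideals is the span of its union; for the empty family it is \<open>{0}\<close>, so the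
  zero algebra is pseudo-abelian.
\<close>

definition pseudo_abelian :: "('f::field \<Rightarrow> 'a::ring \<Rightarrow> 'a) \<Rightarrow> bool"
  where "pseudo_abelian scale \<longleftrightarrow>
    module.span scale (\<Union>{I. minimal_ideal scale I \<and> is_skew_field I}) = UNIV"

end

theory Submission
  imports Defs "HOL-Computational_Algebra.Fundamental_Theorem_Algebra"
begin

text \<open>
  Only \<open>0\<close> is orthogonal to itself, and \<open>0\<close> is orthogonal to everything, so the double perp
  of the left-symmetric set \<open>L\<close> is everything exactly when the perp of \<open>L\<close> is trivial
  (\<open>set_perp_set_perp_eq_UNIV_iff\<close>). What remains is to find the left-symmetric elements. The
  argument does so without decomposing the algebra into matrix blocks; minimal projections take
  the place of the blocks, and the blocks of size one correspond to the minimal projections that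
  are central.

  \<^item> A left-symmetric \<open>v \<noteq> 0\<close> cannot be split as \<open>a + b\<close>, with \<open>a, b \<noteq> 0\<close>, such that the norm of
  every combination of \<open>a\<close> and \<open>b\<close> is the maximum of the norms of the two parts
  (\<open>not_left_symmetric_max_norm_sum\<close>). The spectral projections of \<open>v\<^sup>*v\<close> provide
  such splittings, so \<open>v\<^sup>*v\<close> must be a multiple of a minimal projection \<open>q\<close>
  (\<open>left_symmetric_minimal_support\<close>).

  \<^item> If \<open>q\<close> is not central, then there are off-diagonal elements both at \<open>q\<close> and at the range
  projection of \<open>v\<close>. They turn \<open>v\<close> into the matrix unit \<open>E\<^sub>1\<^sub>1\<close> of a \<open>2 \<times> 2\<close> matrix corner, in
  which the symmetric matrix with rows \<open>0, 2\<close> and \<open>2, 3\<close> shows that left symmetry fails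
  (\<open>not_left_symmetric_noncentral_support\<close>). Hence \<open>q\<close> is central, \<open>v\<close> is killed by every noncentral
  minimal projection \<open>p\<close>, and \<open>p\<close> lies in the perp of \<open>L\<close>. So if the perp of \<open>L\<close> is trivial,
  all minimal projections are central. In that case they are finitely many, sum to a unit and
  generate minimal ideals that are skew-fields.

  \<^item> Conversely, a minimal ideal that is a skew-field is the corner of a central minimal projection
  \<open>e\<close>. Its norm comes from an inner product, since \<open>x\<^sup>*x = \<parallel>x\<parallel>\<^sup>2 e\<close> there, so that orthogonality
  is symmetric inside the ideal; and the norm of the algebra is the maximum of the norms of the parts
  under \<open>e\<close> and under its complement. So all elements of the ideal are left-symmetric
  (\<open>left_symmetric_central_corner\<close>). An element \<open>w\<close> of the perp of \<open>L\<close> then satisfies \<open>ew \<bottom> w\<close>, which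
  forces \<open>ew = 0\<close>. If such ideals span the algebra, \<open>w = 0\<close>.

  The only spectral theory behind this is that a nonzero self-adjoint element has a nonzero
  eigenprojection with real nonzero eigenvalue (\<open>exists_eigenprojection\<close>). It is proved by factoring
  a minimal polynomial over the reals; quadratic factors are excluded because no corner contains
  a self-adjoint square root of minus its unit. The last fact holds over both scalar fields, but for
  different reasons: over \<open>\<real>\<close> because \<open>1 + x\<^sup>*x\<close> is invertible, over \<open>\<complex>\<close> because of the C*-identity.
\<close>

section \<open>Powers and real polynomials\<close>

text \<open>
  A constant factor is lost under arbitrarily high powers.
\<close>

lemma le_if_power_two_power_le:
  fixes x m :: real
  assumes "0 \<le> m" and le: "\<And>n::nat. x ^ (2 ^ n) \<le> 2 * m ^ (2 ^ n)"
  shows "x \<le> m"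
proof (rule ccontr)
  assume "\<not> x \<le> m"
  then have "m < x" by simp
  show False
  proof (cases "m = 0")
    case True
    then show False using le[of 0] \<open>m < x\<close> by simp
  next
    case False
    then have "0 < m" using assms(1) by simp
    then have gt: "1 < x / m" using \<open>m < x\<close> by simp
    obtain n where n: "2 < (x / m) ^ n" using real_arch_pow[OF gt] by blast
    have "(x / m) ^ n \<le> (x / m) ^ (2 ^ n)"
      using gt by (intro power_increasing) (auto simp: less_imp_le)
    also have "\<dots> \<le> 2"
      using le[of n] \<open>0 < m\<close> by (simp add: power_divide divide_le_eq)
    finally show False using n by simp
  qed
qed

lemma real_poly_root_or_quadratic_factor:
  fixes p :: "real poly"
  assumes "degree p > 0"
  obtains r where "poly p r = 0"
  | a b where "b \<noteq> 0" and "[:a\<^sup>2 + b\<^sup>2, - 2 * a, 1:] dvd p"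
proof -
  define ev where "ev q z = poly (map_poly complex_of_real q) z" for q z
  have ev_0: "ev 0 z = 0" for z by (simp add: ev_def)
  have ev_pCons: "ev (pCons a q) z = of_real a + z * ev q z" for a q z
    by (simp add: ev_def map_poly_pCons)
  have ev_add: "ev (q + r) z = ev q z + ev r z" for q r z
    by (induction q r rule: poly_induct2) (simp_all add: ev_0 ev_pCons algebra_simps)
  have ev_smult: "ev (smult c q) z = of_real c * ev q z" for c q z
    by (induction q) (simp_all add: ev_0 ev_pCons algebra_simps)
  have ev_mult: "ev (q * r) z = ev q z * ev r z" for q r z
    by (induction q) (simp_all add: ev_0 ev_pCons ev_add ev_smult algebra_simps)
  have ev_real: "ev q (of_real x) = of_real (poly q x)" for q x
    by (induction q) (simp_all add: ev_0 ev_pCons)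
  have "degree (map_poly complex_of_real p) = degree p" by (rule degree_map_poly) auto
  then have "\<not> constant (poly (map_poly complex_of_real p))"
    using assms by (simp add: constant_degree)
  then obtain z where z: "ev p z = 0"
    using fundamental_theorem_of_algebra unfolding ev_def by blast
  show thesis
  proof (cases "Im z = 0")
    case True
    then have "z = of_real (Re z)" by (simp add: complex_eq_iff)
    then have "poly p (Re z) = 0" using z ev_real[of p "Re z"] by simp
    then show thesis using that(1) by simp
  next
    case False
    define a b where "a = Re z" and "b = Im z"
    \<comment> \<open>\<open>d\<close> is the minimal polynomial of \<open>z\<close>; the remainder is linear with a nonreal root, hence zero.\<close>
    define d where "d = [:a\<^sup>2 + b\<^sup>2, - 2 * a, 1:]"
    define r where "r = p mod d"
    have "d \<noteq> 0" and "degree d = 2" by (simp_all add: d_def)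
    then have "r = 0 \<or> degree r < 2"
      using degree_mod_less[of d p] unfolding r_def by simp
    then have "degree r \<le> 1" by auto
    then obtain c0 c1 where r: "r = [:c0, c1:]"
      by (metis One_nat_def degree_pCons_eq degree_eq_zeroE le_zero_eq nat.inject pCons_cases
          le_SucE pCons_0_0)
    have d0: "ev d z = 0"
      by (simp add: d_def ev_0 ev_pCons a_def b_def complex_eq_iff power2_eq_square algebra_simps)
    have "p = d * (p div d) + r" by (simp add: r_def)
    then have "ev r z = 0" using z d0 ev_add ev_mult by (metis add_0 mult_zero_left)
    then have "of_real c0 + z * of_real c1 = 0" by (simp add: r ev_0 ev_pCons)
    then have "c1 = 0" and "c0 = 0" using False by (auto simp: complex_eq_iff)
    then have "d dvd p" using r by (simp add: r_def dvd_eq_mod_eq_0)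
    then show thesis using that(2)[of b a] False by (simp add: d_def b_def)
  qed
qed

section \<open>Polynomials acting by left multiplication\<close>

text \<open>
  This is \<open>p(k) x\<close>. Without a unit \<open>p(k)\<close> itself need not be an element of the algebra, but its
  action on elements is defined.
\<close>

definition poly_act :: "'a::real_algebra \<Rightarrow> real poly \<Rightarrow> 'a \<Rightarrow> 'a"
  where "poly_act k p x = fold_coeffs (\<lambda>a y. a *\<^sub>R x + k * y) p 0"

lemma poly_act_0 [simp]: "poly_act k 0 x = 0"
  by (simp add: poly_act_def)

lemma poly_act_pCons [simp]: "poly_act k (pCons a p) x = a *\<^sub>R x + k * poly_act k p x"
  by (cases "p = 0 \<and> a = 0")
    (auto simp: poly_act_def fold_coeffs_pCons_coeff_not_0_eq fold_coeffs_pCons_not_0_0_eq)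

lemma poly_act_add: "poly_act k (p + q) x = poly_act k p x + poly_act k q x"
  by (induction p q rule: poly_induct2) (simp_all add: algebra_simps)

lemma poly_act_smult: "poly_act k (smult c p) x = c *\<^sub>R poly_act k p x"
  by (induction p) (simp_all add: algebra_simps)

lemma poly_act_mult: "poly_act k (p * q) x = poly_act k p (poly_act k q x)"
  by (induction p) (simp_all add: poly_act_add poly_act_smult)

lemma poly_act_sum: "poly_act k (sum f A) x = (\<Sum>i\<in>A. poly_act k (f i) x)"
  by (induction A rule: infinite_finite_induct) (simp_all add: poly_act_add)

lemma poly_act_mult_right: "poly_act k p (x * y) = poly_act k p x * y"
  by (induction p) (simp_all add: algebra_simps mult.assoc)

lemma poly_act_commute: "poly_act k p (k * x) = k * poly_act k p x"
  by (induction p) (simp_all add: algebra_simps)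

lemma poly_act_eigenvector:
  assumes "k * x = r *\<^sub>R x"
  shows "poly_act k p x = poly p r *\<^sub>R x"
  by (induction p) (simp_all add: assms algebra_simps)

text \<open>
  The plane spanned by \<open>x\<close> and \<open>kx\<close> is invariant under \<open>k\<close>, hence under every polynomial in \<open>k\<close>.
\<close>

lemma poly_act_quadratic:
  assumes "k * (k * x) = a *\<^sub>R x + b *\<^sub>R (k * x)"
  shows "\<exists>s t. poly_act k p x = s *\<^sub>R x + t *\<^sub>R (k * x)"
proof (induction p)
  case 0
  show ?case by (intro exI[of _ 0]) simp
next
  case (pCons c p)
  then obtain s t where "poly_act k p x = s *\<^sub>R x + t *\<^sub>R (k * x)" by blast
  then have "poly_act k (pCons c p) x = (c + t * a) *\<^sub>R x + (s + t * b) *\<^sub>R (k * x)"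
    using assms by (simp add: algebra_simps)
  then show ?case by blast
qed

lemma exists_annihilating_poly:
  fixes k x :: "'a::real_algebra"
  assumes "finite B" and "span B = (UNIV :: 'a set)"
  shows "\<exists>p. p \<noteq> 0 \<and> poly_act k p x = 0"
proof -
  define v where "v i = poly_act k (monom 1 i) x" for i
  show ?thesis
  proof (cases "inj v")
    case False
    then obtain i j where "i \<noteq> j" and "v i = v j" by (auto simp: inj_on_def)
    then have "poly_act k (monom 1 i + smult (-1) (monom 1 j)) x = 0"
      by (simp only: poly_act_add poly_act_smult) (simp add: v_def)
    moreover have "coeff (monom 1 i + smult (-1) (monom 1 j)) i = (1::real)"
      using \<open>i \<noteq> j\<close> by simp
    then have "monom 1 i + smult (-1) (monom 1 j) \<noteq> (0 :: real poly)" by (metis coeff_0 zero_neq_one)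
    ultimately show ?thesis by blast
  next
    case True
    then have "infinite (range v)" by (simp add: finite_image_iff)
    then have "dependent (range v)"
      using independent_span_bound[OF assms(1), of "range v"] assms(2) by auto
    then obtain S u where S: "finite S" "S \<subseteq> range v" "(\<Sum>w\<in>S. u w *\<^sub>R w) = 0" "\<exists>w\<in>S. u w \<noteq> 0"
      unfolding dependent_explicit by blast
    obtain I where I: "S = v ` I" using S(2) by (meson subset_imageE)
    have inj: "inj_on v I" using True by (rule inj_on_subset) simp
    have "finite I" using S(1) inj unfolding I by (simp add: finite_image_iff)
    define p where "p = (\<Sum>i\<in>I. smult (u (v i)) (monom 1 i))"
    have "poly_act k p x = (\<Sum>i\<in>I. u (v i) *\<^sub>R v i)"
      by (simp only: p_def poly_act_sum poly_act_smult v_def)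
    also have "\<dots> = 0" using S(3) by (simp add: I sum.reindex[OF inj])
    finally have act: "poly_act k p x = 0" .
    obtain i where "i \<in> I" and "u (v i) \<noteq> 0" using S(4) I by blast
    moreover have "coeff p i = u (v i)" if "i \<in> I" for i
      using that \<open>finite I\<close> by (simp add: p_def coeff_sum if_distrib[of "\<lambda>y. _ * y"] cong: if_cong)
    ultimately have "p \<noteq> 0" by (metis coeff_0)
    then show ?thesis using act by blast
  qed
qed

section \<open>Formally real C*-algebras and their projections\<close>

text \<open>
  The common part of the real and the complex theory, formulated with real scalars. Positivity of
  \<open>x\<^sup>*x\<close> enters only through \<open>formally_real\<close>: in a corner with unit \<open>e\<close>, no self-adjoint
  element squares to \<open>-e\<close>.
\<close>

locale formally_real_cstar =
  fixes star :: "'a::real_normed_algebra \<Rightarrow> 'a"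
  assumes star_star [simp]: "star (star x) = x"
    and star_add: "star (x + y) = star x + star y"
    and star_scaleR: "star (r *\<^sub>R x) = r *\<^sub>R star x"
    and star_mult: "star (x * y) = star y * star x"
    and cstar_identity: "norm (star x * x) = (norm x)\<^sup>2"
    and formally_real: "star k = k \<Longrightarrow> star e = e \<Longrightarrow> e * e = e \<Longrightarrow> e * k = k \<Longrightarrow> k * e = k \<Longrightarrow>
      k * k = - e \<Longrightarrow> e = 0"
    and finite_span: "\<exists>B. finite B \<and> span B = (UNIV :: 'a set)"
begin

lemma star_0 [simp]: "star 0 = 0"
  using star_scaleR[of 0 0] by simp

lemma star_minus: "star (- x) = - star x"
  using star_scaleR[of "-1" x] by simp

lemma star_diff: "star (x - y) = star x - star y"
  using star_add[of x "- y"] by (simp add: star_minus)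

lemmas star_simps = star_add star_diff star_minus star_scaleR star_mult

lemma star_mult_self_eq_0 [simp]: "star x * x = 0 \<longleftrightarrow> x = 0"
  using cstar_identity[of x] by auto

lemma self_adjoint_square_eq_0: "star x = x \<Longrightarrow> x * x = 0 \<longleftrightarrow> x = 0"
  using star_mult_self_eq_0[of x] by simp

lemma norm_star [simp]: "norm (star x) = norm x"
proof -
  have le: "norm y \<le> norm (star y)" for y
  proof (cases "y = 0")
    case False
    have "norm y * norm y \<le> norm (star y) * norm y"
      using norm_mult_ineq[of "star y" y] by (simp add: cstar_identity power2_eq_square)
    then show ?thesis using False by simp
  qed simp
  show ?thesis using le[of x] le[of "star x"] by simp
qed

lemma cstar_identity': "norm (x * star x) = (norm x)\<^sup>2"
  using cstar_identity[of "star x"] by simp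

definition projection :: "'a \<Rightarrow> bool"
  where "projection e \<longleftrightarrow> star e = e \<and> e * e = e"

lemma projection_star: "projection e \<Longrightarrow> star e = e"
  and projection_idem: "projection e \<Longrightarrow> e * e = e"
  by (auto simp: projection_def)

lemma projection_idem_left: "projection e \<Longrightarrow> e * (e * x) = e * x"
  by (metis projection_idem mult.assoc)

lemma norm_projection:
  assumes "projection e" and "e \<noteq> 0"
  shows "norm e = 1"
  using cstar_identity[of e] assms by (simp add: projection_def power2_eq_square)

lemma norm_projection_le: "projection e \<Longrightarrow> norm e \<le> 1"
  by (cases "e = 0") (simp_all add: norm_projection)

lemma norm_mult_projection_le:
  assumes "projection e"
  shows "norm (x * e) \<le> norm x"
proof -
  have "norm (x * e) \<le> norm x * norm e" by (rule norm_mult_ineq)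
  also have "\<dots> \<le> norm x * 1"
    using norm_projection_le[OF assms] by (intro mult_left_mono) auto
  finally show ?thesis by simp
qed

text \<open>
  Right multiplication by the formal element \<open>1 - e\<close> is a contraction. As there may be no unit,
  the bound \<open>\<parallel>1 - e\<parallel> \<le> 1\<close> is replaced by \<open>(x(1 - e))(x(1 - e))\<^sup>* = x(1 - e)x\<^sup>*\<close>.
\<close>

lemma norm_mult_complement_le:
  assumes "projection e"
  shows "norm (x - x * e) \<le> norm x"
proof (cases "x - x * e = 0")
  case False
  have "(x - x * e) * star (x - x * e) = (x - x * e) * star x"
    using assms by (simp add: star_simps projection_star algebra_simps projection_idem_left)
  then have "norm (x - x * e) * norm (x - x * e) = norm ((x - x * e) * star x)"
    by (metis cstar_identity' power2_eq_square)
  also have "\<dots> \<le> norm (x - x * e) * norm x"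
    using norm_mult_ineq[of "x - x * e" "star x"] by simp
  finally show ?thesis using False by simp
qed simp

text \<open>
  Squaring keeps the two summands orthogonal and, by the C*-identity, squares all three norms; the
  triangle inequality for the \<open>2\<^sup>n\<close>-th powers is therefore much sharper than the one for \<open>a\<close> and \<open>b\<close>.
\<close>

lemma norm_add_orthogonal_self_adjoint_power:
  "star a = a \<Longrightarrow> star b = b \<Longrightarrow> a * b = 0 \<Longrightarrow>
    norm (a + b) ^ (2 ^ n) \<le> norm a ^ (2 ^ n) + norm b ^ (2 ^ n)"
proof (induction n arbitrary: a b)
  case 0
  then show ?case by (simp add: norm_triangle_ineq)
next
  case (Suc n)
  have ba: "b * a = 0"
    using Suc.prems star_mult[of a b] by simp
  have sq: "(norm x)\<^sup>2 = norm (x * x)" if "star x = x" for x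
    using cstar_identity[of x] that by simp
  have "norm (a + b) ^ (2 ^ Suc n) = norm (a * a + b * b) ^ (2 ^ n)"
    using sq[of "a + b"] Suc.prems ba by (simp add: power_mult star_add algebra_simps)
  also have "\<dots> \<le> norm (a * a) ^ (2 ^ n) + norm (b * b) ^ (2 ^ n)"
  proof (rule Suc.IH)
    have "a * a * (b * b) = a * (a * b) * b" by (simp only: mult.assoc)
    then show "a * a * (b * b) = 0" using Suc.prems by simp
  qed (use Suc.prems in \<open>simp_all add: star_mult\<close>)
  also have "\<dots> = norm a ^ (2 ^ Suc n) + norm b ^ (2 ^ Suc n)"
    using sq[of a] sq[of b] Suc.prems by (simp add: power_mult)
  finally show ?case .
qed

text \<open>
  The hypotheses say that \<open>a\<close> and \<open>b\<close> have orthogonal ranges and orthogonal supports. Then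
  \<open>(a + b)\<^sup>*(a + b) = a\<^sup>*a + b\<^sup>*b\<close> is a sum of orthogonal self-adjoint elements.
\<close>

lemma norm_add_orthogonal_le:
  assumes "star a * b = 0" and "a * star b = 0"
  shows "norm (a + b) \<le> max (norm a) (norm b)"
proof -
  define A B where "A = star a * a" and "B = star b * b"
  define m where "m = max (norm A) (norm B)"
  have sa: "star A = A" "star B = B" by (simp_all add: A_def B_def star_mult)
  have "A * B = star a * (a * star b) * b" by (simp only: A_def B_def mult.assoc)
  then have AB: "A * B = 0" using assms by simp
  have "star b * a = 0" using assms(1) star_mult[of "star a" b] by simp
  then have sq: "star (a + b) * (a + b) = A + B"
    using assms by (simp add: A_def B_def star_add algebra_simps)
  have "norm (A + B) \<le> m"
  proof (rule le_if_power_two_power_le)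
    fix n :: nat
    have "norm (A + B) ^ (2 ^ n) \<le> norm A ^ (2 ^ n) + norm B ^ (2 ^ n)"
      using norm_add_orthogonal_self_adjoint_power[OF sa AB] .
    also have "\<dots> \<le> m ^ (2 ^ n) + m ^ (2 ^ n)"
      by (intro add_mono power_mono) (auto simp: m_def)
    finally show "norm (A + B) ^ (2 ^ n) \<le> 2 * m ^ (2 ^ n)" by simp
  qed (auto simp: m_def le_max_iff_disj)
  also have "m = (max (norm a) (norm b))\<^sup>2"
    by (auto simp: m_def A_def B_def cstar_identity max_def power2_eq_square
        mult_mono' dest: mult_strict_mono' intro: antisym)
  finally have "(norm (a + b))\<^sup>2 \<le> (max (norm a) (norm b))\<^sup>2"
    using sq cstar_identity[of "a + b"] by simp
  then show ?thesis by (rule power2_le_imp_le) (simp add: le_max_iff_disj)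
qed

section \<open>Eigenprojections of self-adjoint elements\<close>

text \<open>
  The relations say that the plane spanned by \<open>u\<close> and \<open>m\<close> is closed under multiplication and that
  \<open>m\<close> is \<open>i\<close> times \<open>u\<close> for a complex structure on it, with \<open>u\<^sup>2 = (a + ib) u\<close>. If \<open>u \<noteq> 0\<close>, dividing
  by \<open>a + ib\<close> produces the unit \<open>e\<close> of the plane and the element \<open>j\<close> that plays the role of \<open>i\<close>.
\<close>

lemma no_imaginary_unit:
  assumes sa: "star u = u" "star m = m"
    and uu: "u * u = a *\<^sub>R u + b *\<^sub>R m" and um: "u * m = a *\<^sub>R m - b *\<^sub>R u"
    and mu: "m * u = a *\<^sub>R m - b *\<^sub>R u" and mm: "m * m = - (u * u)"
  shows "u = 0"
proof (rule ccontr)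
  assume "u \<noteq> 0"
  then have "u * u \<noteq> 0" using self_adjoint_square_eq_0[OF sa(1)] by simp
  define n where "n = a * a + b * b"
  have n: "n \<noteq> 0"
    using \<open>u * u \<noteq> 0\<close> uu by (auto simp: n_def sum_squares_eq_zero_iff)
  define e where "e = (1 / n) *\<^sub>R (a *\<^sub>R u - b *\<^sub>R m)"
  define j where "j = (1 / n) *\<^sub>R (a *\<^sub>R m + b *\<^sub>R u)"
  have solve: "(1 / n) *\<^sub>R (a *\<^sub>R (a *\<^sub>R x) + b *\<^sub>R (b *\<^sub>R x)) = x" for x :: 'a
  proof -
    have "a *\<^sub>R (a *\<^sub>R x) + b *\<^sub>R (b *\<^sub>R x) = n *\<^sub>R x"
      by (simp only: n_def scaleR_add_left scaleR_scaleR)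
    then show ?thesis using n by simp
  qed
  have eu: "e * u = u"
  proof -
    have "e * u = (1 / n) *\<^sub>R (a *\<^sub>R (a *\<^sub>R u) + b *\<^sub>R (b *\<^sub>R u))"
      by (simp add: e_def uu mu algebra_simps)
    then show ?thesis by (simp only: solve)
  qed
  have em: "e * m = m"
  proof -
    have "e * m = (1 / n) *\<^sub>R (a *\<^sub>R (a *\<^sub>R m) + b *\<^sub>R (b *\<^sub>R m))"
      by (simp add: e_def uu um mm algebra_simps)
    then show ?thesis by (simp only: solve)
  qed
  have ju: "j * u = m"
  proof -
    have "j * u = (1 / n) *\<^sub>R (a *\<^sub>R (a *\<^sub>R m) + b *\<^sub>R (b *\<^sub>R m))"
      by (simp add: j_def uu mu algebra_simps)
    then show ?thesis by (simp only: solve)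
  qed
  have jm: "j * m = - u"
  proof -
    have "j * m = (1 / n) *\<^sub>R (a *\<^sub>R (a *\<^sub>R (- u)) + b *\<^sub>R (b *\<^sub>R (- u)))"
      by (simp add: j_def uu um mm algebra_simps)
    then show ?thesis by (simp only: solve)
  qed
  have ej: "e * j = j" by (simp add: j_def eu em algebra_simps)
  have ee: "e * e = e" by (subst (2 3) e_def) (simp add: eu em algebra_simps)
  have sae: "star e = e" and saj: "star j = j"
    by (simp_all add: e_def j_def star_simps sa)
  have je: "j * e = j" using ej star_mult[of e j] by (simp add: sae saj)
  have "j * j = (1 / n) *\<^sub>R (a *\<^sub>R (j * m) + b *\<^sub>R (j * u))"
    by (subst (2) j_def) (simp add: algebra_simps)
  then have "j * j = - e" by (simp add: ju jm e_def algebra_simps)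
  then have "e = 0" using formally_real[OF saj sae ee ej je] by simp
  then show False using eu \<open>u \<noteq> 0\<close> by simp
qed

text \<open>
  Let \<open>p\<close> have least degree among the nonzero polynomials with \<open>p(k) k = 0\<close>. If \<open>p\<close> has a real root
  \<open>r\<close>, then cancelling the factor gives an element \<open>u \<noteq> 0\<close> with \<open>ku = ru\<close> that is a polynomial in
  \<open>k\<close>, so that \<open>u\<^sup>2\<close> is a multiple of \<open>u\<close> and \<open>u\<close> can be scaled to a projection. If \<open>p\<close> has a real quadratic
  factor without real root, then the same cancellation produces the forbidden plane of
  \<open>no_imaginary_unit\<close>.
\<close>

theorem exists_eigenprojection:
  assumes sa: "star k = k" and "k \<noteq> 0"
  obtains e r where "projection e" and "e \<noteq> 0" and "r \<noteq> 0"
    and "k * e = r *\<^sub>R e" and "e * k = r *\<^sub>R e"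
proof -
  obtain B where "finite B" "span B = (UNIV :: 'a set)" using finite_span by blast
  then have "\<exists>p. p \<noteq> 0 \<and> poly_act k p k = 0" by (rule exists_annihilating_poly)
  then obtain p where p: "p \<noteq> 0" "poly_act k p k = 0"
    and minimal: "\<And>q. q \<noteq> 0 \<Longrightarrow> poly_act k q k = 0 \<Longrightarrow> degree p \<le> degree q"
    using exists_least_iff[of "\<lambda>n. \<exists>p. p \<noteq> 0 \<and> poly_act k p k = 0 \<and> degree p = n"]
    by (metis not_le)
  have "degree p > 0"
  proof (rule ccontr)
    assume "\<not> degree p > 0"
    then obtain c where "p = [:c:]" by (metis degree_eq_zeroE not_gr0)
    then show False using p \<open>k \<noteq> 0\<close> by simp
  qed
  have comm: "poly_act k q k * k = k * poly_act k q k" for q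
    using poly_act_mult_right[of k q k k] poly_act_commute[of k q k] by simp
  have star_act: "star (poly_act k q k) = poly_act k q k" for q
  proof (induction q)
    case (pCons a q)
    then show ?case using comm[of q] by (simp add: star_simps sa)
  qed simp
  from \<open>degree p > 0\<close> show thesis
  proof (cases rule: real_poly_root_or_quadratic_factor)
    case (1 r)
    then obtain q where pq: "p = [:- r, 1:] * q" by (metis poly_eq_0_iff_dvd dvdE)
    have "q \<noteq> 0" using p pq by auto
    then have "degree q < degree p"
      unfolding pq by (subst degree_mult_eq) auto
    define u where "u = poly_act k q k"
    have "u \<noteq> 0" using minimal[OF \<open>q \<noteq> 0\<close>] \<open>degree q < degree p\<close> by (auto simp: u_def)
    have sau: "star u = u" by (simp add: u_def star_act)
    have "poly_act k [:- r, 1:] u = 0"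
      using p(2) unfolding pq poly_act_mult u_def .
    then have ku: "k * u = r *\<^sub>R u" by simp
    have uk: "u * k = r *\<^sub>R u" using ku comm[of q] by (simp add: u_def)
    define s where "s = r * poly q r"
    have "u * u = poly_act k q (k * u)" by (simp add: u_def poly_act_mult_right)
    also have "\<dots> = s *\<^sub>R u"
      by (simp only: poly_act_commute poly_act_eigenvector[OF ku])
        (simp add: ku s_def mult.commute)
    finally have uu: "u * u = s *\<^sub>R u" .
    then have "s \<noteq> 0" using \<open>u \<noteq> 0\<close> self_adjoint_square_eq_0[OF sau] by auto
    show thesis
    proof (rule that)
      show "projection ((1 / s) *\<^sub>R u)"
        using uu \<open>s \<noteq> 0\<close> by (simp add: projection_def star_simps sau)
      show "(1 / s) *\<^sub>R u \<noteq> 0" using \<open>s \<noteq> 0\<close> \<open>u \<noteq> 0\<close> by simp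
      show "r \<noteq> 0" using \<open>s \<noteq> 0\<close> by (auto simp: s_def)
    qed (simp_all add: ku uk)
  next
    case (2 a b)
    define d where "d = [:a\<^sup>2 + b\<^sup>2, - 2 * a, 1:]"
    obtain q where pq: "p = d * q" using 2(2) unfolding d_def by (elim dvdE)
    have "q \<noteq> 0" using p pq by auto
    then have "degree q < degree p"
      unfolding pq by (subst degree_mult_eq) (auto simp: d_def)
    define u where "u = poly_act k q k"
    have "u \<noteq> 0" using minimal[OF \<open>q \<noteq> 0\<close>] \<open>degree q < degree p\<close> by (auto simp: u_def)
    have sau: "star u = u" by (simp add: u_def star_act)
    have uk: "u * k = k * u" using comm[of q] by (simp add: u_def)
    have "poly_act k d u = 0"
      using p(2) unfolding pq poly_act_mult u_def .
    then have kku: "k * (k * u) = (2 * a) *\<^sub>R (k * u) - (a\<^sup>2 + b\<^sup>2) *\<^sub>R u"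
      by (simp add: d_def algebra_simps)
    define m where "m = (1 / b) *\<^sub>R (k * u - a *\<^sub>R u)"
    have ku: "k * u = a *\<^sub>R u + b *\<^sub>R m" using 2 by (simp add: m_def)
    have km: "k * m = a *\<^sub>R m - b *\<^sub>R u"
    proof -
      have "k * (k * u) = a *\<^sub>R (k * u) + b *\<^sub>R (k * m)" by (subst ku) (simp add: algebra_simps)
      then have "b *\<^sub>R (k * m) = k * (k * u) - a *\<^sub>R (k * u)" by simp
      also have "\<dots> = (2 * a - a) *\<^sub>R (k * u) - (a\<^sup>2 + b\<^sup>2) *\<^sub>R u"
        unfolding kku scaleR_left_diff_distrib by simp
      also have "\<dots> = b *\<^sub>R (a *\<^sub>R m - b *\<^sub>R u)"
        by (simp add: ku algebra_simps power2_eq_square)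
      finally show ?thesis using 2 by simp
    qed
    have sam: "star m = m" by (simp add: m_def star_simps sau sa uk)
    \<comment> \<open>\<open>u\<^sup>2\<close> is a polynomial in \<open>k\<close> applied to \<open>u\<close>, so it stays in the plane of \<open>u\<close> and \<open>m\<close>.\<close>
    have "k * (k * u) = (- (a\<^sup>2 + b\<^sup>2)) *\<^sub>R u + (2 * a) *\<^sub>R (k * u)"
      unfolding kku scaleR_minus_left by simp
    then obtain s t where st: "poly_act k q u = s *\<^sub>R u + t *\<^sub>R (k * u)"
      using poly_act_quadratic by blast
    have "u * u = k * poly_act k q u"
      by (simp add: u_def poly_act_mult_right[symmetric] poly_act_commute[symmetric])
    also have "\<dots> = (s * a + t * (a\<^sup>2 - b\<^sup>2)) *\<^sub>R u + (s * b + 2 * t * a * b) *\<^sub>R m"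
      unfolding st distrib_left mult_scaleR_right kku ku
      by (simp add: km algebra_simps power2_eq_square scaleR_2)
        (simp flip: scaleR_left_distrib)
    finally obtain \<alpha> \<beta> where uu: "u * u = \<alpha> *\<^sub>R u + \<beta> *\<^sub>R m" by blast
    have mx: "m * x = (1 / b) *\<^sub>R (k * (u * x) - a *\<^sub>R (u * x))" for x
      by (simp add: m_def algebra_simps mult.assoc)
    have mu: "m * u = \<alpha> *\<^sub>R m - \<beta> *\<^sub>R u"
      using 2 by (simp add: mx uu ku km algebra_simps)
    have um: "u * m = \<alpha> *\<^sub>R m - \<beta> *\<^sub>R u"
      using mu star_mult[of m u] by (simp add: star_simps sau sam)
    have mm: "m * m = - (u * u)"
      using 2 by (simp add: mx um uu ku km algebra_simps)
    show thesis using no_imaginary_unit[OF sau sam uu um mu mm] \<open>u \<noteq> 0\<close> by simp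
  qed
qed

section \<open>Minimal projections\<close>

definition minimal_projection :: "'a \<Rightarrow> bool"
  where "minimal_projection q \<longleftrightarrow> projection q \<and> q \<noteq> 0 \<and>
    (\<forall>e. projection e \<and> e * q = e \<and> q * e = e \<longrightarrow> e = 0 \<or> e = q)"

definition central :: "'a \<Rightarrow> bool"
  where "central z \<longleftrightarrow> (\<forall>x. z * x = x * z)"

lemma minimal_projectionD:
  assumes "minimal_projection q"
  shows "projection q" and "q \<noteq> 0" and "star q = q" and "q * q = q"
    and "\<And>x. q * (q * x) = q * x"
    and "\<And>e. projection e \<Longrightarrow> e * q = e \<Longrightarrow> q * e = e \<Longrightarrow> e = 0 \<or> e = q"
  using assms unfolding minimal_projection_def projection_def
  by (auto simp flip: mult.assoc)

text \<open>
  Among the nonzero projections below \<open>q\<close>, one that generates a right ideal of least dimension is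
  minimal.
\<close>

lemma exists_minimal_projection_below:
  assumes "projection q" and "q \<noteq> 0"
  obtains e where "minimal_projection e" and "q * e = e"
proof -
  obtain B where "finite B" "span B = (UNIV :: 'a set)" using finite_span by blast
  obtain C where C: "C \<subseteq> B" "independent C" "B \<subseteq> span C" using maximal_independent_subset[of B] by metis
  interpret fd: finite_dimensional_vector_space "scaleR :: real \<Rightarrow> 'a \<Rightarrow> 'a" C
  proof (unfold_locales, fold dependent_raw_def span_raw_def)
    show "finite C" using C \<open>finite B\<close> finite_subset by blast
    show "independent C" using C(2) .
    show "span C = (UNIV :: 'a set)"
      using C(3) span_mono[OF C(3)] \<open>span B = UNIV\<close> by (metis span_span top.extremum_uniqueI)
  qed
  define d where "d e = dim (range (\<lambda>x. e * x))" for e :: 'a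
  have sub: "span (range (\<lambda>x. e * x)) = range (\<lambda>x. e * x)" for e :: 'a
  proof (subst span_eq_iff, rule subspaceI)
    show "0 \<in> range (\<lambda>x. e * x)" by (metis mult_zero_right rangeI)
    show "x + y \<in> range (\<lambda>x. e * x)" if "x \<in> range (\<lambda>x. e * x)" "y \<in> range (\<lambda>x. e * x)" for x y
      using that by (metis (no_types, lifting) distrib_left rangeE rangeI)
    show "c *\<^sub>R x \<in> range (\<lambda>x. e * x)" if "x \<in> range (\<lambda>x. e * x)" for c x
      using that by (metis (no_types, lifting) mult_scaleR_right rangeE rangeI)
  qed
  obtain e where e: "projection e" "e \<noteq> 0" "q * e = e"
    and least: "\<And>f. projection f \<Longrightarrow> f \<noteq> 0 \<Longrightarrow> q * f = f \<Longrightarrow> d e \<le> d f"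
  proof -
    let ?P = "\<lambda>f. projection f \<and> f \<noteq> 0 \<and> q * f = f"
    have "?P q" using assms by (simp add: projection_idem)
    then show thesis using ex_has_least_nat[of ?P q d] that by blast
  qed
  have "minimal_projection e"
    unfolding minimal_projection_def
  proof (intro conjI allI impI)
    fix f assume f: "projection f \<and> f * e = f \<and> e * f = f"
    show "f = 0 \<or> f = e"
    proof (rule ccontr)
      assume *: "\<not> (f = 0 \<or> f = e)"
      have "e * (f * x) = f * x" for x using f by (metis mult.assoc)
      then have "range (\<lambda>x. f * x) \<subseteq> range (\<lambda>x. e * x)" by (metis image_subsetI rangeI)
      moreover have "e \<notin> range (\<lambda>x. f * x)"
      proof
        assume "e \<in> range (\<lambda>x. f * x)"
        then obtain x where "e = f * x" by blast
        then have "f * e = e" using f projection_idem_left[of f x] by metis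
        then show False using f * by simp
      qed
      moreover have "e \<in> range (\<lambda>x. e * x)" using e by (metis projection_idem rangeI)
      ultimately have "span (range (\<lambda>x. f * x)) \<subset> span (range (\<lambda>x. e * x))"
        unfolding sub by blast
      then have "d f < d e" unfolding d_def by (rule fd.dim_psubset[folded dim_raw_def span_raw_def])
      moreover have "q * f = f" using f e by (metis mult.assoc)
      ultimately show False using least[of f] f * by simp
    qed
  qed (use e in auto)
  then show thesis using that e by blast
qed

text \<open>
  An eigenprojection of \<open>h\<close> lies below \<open>q\<close>, hence equals \<open>q\<close>.
\<close>

lemma minimal_projection_corner_self_adjoint:
  assumes q: "minimal_projection q" and "star h = h" and hq: "h * q = h"
  obtains r where "h = r *\<^sub>R q"
proof (cases "h = 0")
  case True
  then show thesis using that[of 0] by simp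
next
  case False
  have qh: "q * h = h"
    using star_mult[of h q] assms minimal_projectionD(3)[OF q] by simp
  obtain e r where e: "projection e" "e \<noteq> 0" "r \<noteq> 0" "h * e = r *\<^sub>R e" "e * h = r *\<^sub>R e"
    using exists_eigenprojection[OF \<open>star h = h\<close> False] by blast
  have "r *\<^sub>R (e * q) = r *\<^sub>R e" "r *\<^sub>R (q * e) = r *\<^sub>R e"
    using e hq qh by (metis mult_scaleR_left mult.assoc, metis mult_scaleR_right mult.assoc)
  then have "e * q = e" "q * e = e" using e by simp_all
  then have "e = q" using minimal_projectionD(6)[OF q e(1)] e(2) by simp
  then have "h = r *\<^sub>R q" using e hq by simp
  then show thesis by (rule that)
qed

text \<open>
  On the corner of \<open>q\<close> the map \<open>a \<mapsto> a\<^sup>*a\<close> is a real quadratic form that vanishes at \<open>0\<close> only and is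
  positive at \<open>q\<close>. If it were negative at \<open>a\<close>, it would have a zero on the line through \<open>a\<close> with
  direction \<open>q\<close>, which forces \<open>a\<close> to be a multiple of \<open>q\<close>.
\<close>

lemma minimal_projection_corner_star_mult:
  assumes q: "minimal_projection q" and aq: "a * q = a" and qa: "q * a = a"
  obtains r where "r \<ge> 0" and "star a * a = r *\<^sub>R q"
proof -
  note qD = minimal_projectionD[OF q]
  have "star (star a * a) = star a * a" "star a * a * q = star a * a"
    by (simp_all add: star_mult mult.assoc aq)
  then obtain r where r: "star a * a = r *\<^sub>R q"
    using minimal_projection_corner_self_adjoint[OF q] by blast
  have saq: "star a * q = star a" and qsa: "q * star a = star a"
    using star_mult[of q a] star_mult[of a q] qD(3) aq qa by simp_all
  have "star (a + star a) = a + star a" "(a + star a) * q = a + star a"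
    by (simp_all add: star_add add.commute distrib_right aq saq)
  then obtain t where t: "a + star a = t *\<^sub>R q"
    using minimal_projection_corner_self_adjoint[OF q] by blast
  have "r \<ge> 0"
  proof (rule ccontr)
    assume "\<not> r \<ge> 0"
    define d where "d = sqrt (t * t / 4 - r)"
    have "t * t / 4 - r \<ge> 0" using \<open>\<not> r \<ge> 0\<close> zero_le_square[of t] by linarith
    then have "d * d = t * t / 4 - r" by (simp add: d_def)
    define s where "s = d - t / 2"
    have "s * s + s * t + r = d * d - t * t / 4 + r" by (simp add: s_def algebra_simps)
    then have root: "s * s + s * t + r = 0" using \<open>d * d = _\<close> by simp
    have "star (a + s *\<^sub>R q) * (a + s *\<^sub>R q) = star a * a + s *\<^sub>R (a + star a) + (s * s) *\<^sub>R q"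
      by (simp add: star_simps qD qa saq algebra_simps)
    also have "\<dots> = (s * s + s * t + r) *\<^sub>R q" by (simp add: r t algebra_simps)
    finally have "a + s *\<^sub>R q = 0" by (simp add: root)
    then have "a = (- s) *\<^sub>R q" by (simp add: add_eq_0_iff)
    then have "star a * a = (s * s) *\<^sub>R q" by (simp add: star_simps qD)
    then have "r = s * s" using r qD(2) by simp
    then show False using \<open>\<not> r \<ge> 0\<close> by simp
  qed
  then show thesis using r that by blast
qed

text \<open>
  If \<open>b\<^sup>*b = -q\<close> for some \<open>b\<close> off the diagonal, then \<open>b + b\<^sup>*\<close> squares to \<open>-g\<close>, where
  \<open>g = q - bb\<^sup>*\<close> is a projection and acts as a unit on \<open>b + b\<^sup>*\<close>; this is excluded by formal reality.
\<close>

lemma minimal_projection_off_corner_star_mult: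
  assumes q: "minimal_projection q" and bq: "b * q = b" and qb: "q * b = 0"
  obtains r where "r \<ge> 0" and "star b * b = r *\<^sub>R q"
proof -
  note qD = minimal_projectionD[OF q]
  have "star (star b * b) = star b * b" "star b * b * q = star b * b"
    by (simp_all add: star_mult mult.assoc bq)
  then obtain r where r: "star b * b = r *\<^sub>R q"
    using minimal_projection_corner_self_adjoint[OF q] by blast
  have sbq: "star b * q = 0" and qsb: "q * star b = star b"
    using star_mult[of q b] star_mult[of b q] qD(3) bq qb by simp_all
  have "r \<ge> 0"
  proof (rule ccontr)
    assume "\<not> r \<ge> 0"
    \<comment> \<open>The multiple \<open>c\<close> of \<open>b\<close> is normalised to \<open>c\<^sup>*c = -q\<close>.\<close>
    define s where "s = 1 / sqrt (- r)"
    have "s * s * r = - 1" using \<open>\<not> r \<ge> 0\<close> by (simp add: s_def)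
    define c where "c = s *\<^sub>R b"
    have cc: "star c * c = - q"
      using \<open>s * s * r = - 1\<close> by (simp add: c_def star_simps r mult.assoc)
    have c: "c * q = c" "q * c = 0" "star c * q = 0" "q * star c = star c" 
      using bq qb sbq qsb by (simp_all add: c_def star_simps)
    have c2: "c * c = 0" "star c * star c = 0"
      using c by (metis mult.assoc mult_zero_right, metis mult.assoc mult_zero_left)
    define g where "g = q - c * star c"
    have ccc: "c * star c * c = - c" "star c * (c * star c) = - star c"
      using cc c by (metis mult.assoc mult_minus_right, metis mult.assoc mult_minus_left)
    have r2: "c * star c * (c * star c) = - (c * star c)" "q * (c * star c) = 0" "c * star c * q = 0"
      using ccc c by (metis mult.assoc mult_minus_left, metis mult.assoc mult_zero_left, metis mult.assoc mult_zero_right)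
    have "star (c + star c) = c + star c" by (simp add: star_add add.commute)
    moreover have "star g = g" by (simp add: g_def star_simps qD)
    moreover have "g * g = g" by (simp add: g_def left_diff_distrib right_diff_distrib r2 qD)
    moreover have gk: "g * (c + star c) = c + star c"
      by (simp add: g_def left_diff_distrib right_diff_distrib distrib_left ccc c c2 mult.assoc)
        (simp add: c ccc c2 flip: mult.assoc)
    moreover have "(c + star c) * g = c + star c"
      using gk star_mult[of g "c + star c"] by (simp add: \<open>star g = g\<close> \<open>star (c + star c) = c + star c\<close>)
    moreover have "(c + star c) * (c + star c) = - g"
      by (simp add: g_def algebra_simps c2 cc)
    ultimately have "g = 0" by (rule formally_real)
    then have "q * g = 0" by simp
    then show False using qD by (simp add: g_def right_diff_distrib r2)
  qed
  then show thesis using r that by blast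
qed

text \<open>
  The parts of \<open>y\<close> in the corner of \<open>q\<close> and below the diagonal contribute separately to \<open>y\<^sup>*y\<close>, each
  a nonnegative multiple of \<open>q\<close>.
\<close>

theorem star_mult_self_minimal_projection:
  assumes q: "minimal_projection q" and yq: "y * q = y"
  shows "star y * y = (norm y)\<^sup>2 *\<^sub>R q"
proof -
  note qD = minimal_projectionD[OF q]
  obtain r where r: "r \<ge> 0" "star (q * y) * (q * y) = r *\<^sub>R q"
    by (rule minimal_projection_corner_star_mult[OF q, of "q * y"])
      (simp_all add: mult.assoc yq qD)
  obtain s where s: "s \<ge> 0" "star (y - q * y) * (y - q * y) = s *\<^sub>R q"
    by (rule minimal_projection_off_corner_star_mult[OF q, of "y - q * y"])
      (simp_all add: mult.assoc yq qD left_diff_distrib right_diff_distrib)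
  have "star y * y = star (q * y) * (q * y) + star (y - q * y) * (y - q * y)"
    by (simp add: star_simps qD algebra_simps)
  then have eq: "star y * y = (r + s) *\<^sub>R q" by (simp add: r s scaleR_add_left)
  then have "(norm y)\<^sup>2 = r + s"
    using cstar_identity[of y] r s norm_projection[OF qD(1,2)] by simp
  then show ?thesis using eq by simp
qed

text \<open>
  Minimality is invariant under Murray--von Neumann equivalence: conjugation by \<open>v\<close> carries the
  projections below the range projection of \<open>v\<close> to projections below \<open>q\<close>.
\<close>

lemma minimal_projection_transfer:
  assumes q: "minimal_projection q" and vq: "v * q = v" and v: "star v * v = c *\<^sub>R q" and "c \<noteq> 0"
  shows "minimal_projection ((1 / c) *\<^sub>R (v * star v))"
proof -
  note qD = minimal_projectionD[OF q]
  define s where "s = (1 / c) *\<^sub>R (v * star v)"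
  have qv: "q * star v = star v" using star_mult[of v q] vq qD by simp
  have sv: "s * v = v" using \<open>c \<noteq> 0\<close> by (simp add: s_def mult.assoc v vq)
  have vs: "star v * s = star v"
    using \<open>c \<noteq> 0\<close> by (simp add: s_def v qv flip: mult.assoc)
  have ss: "star s = s" by (simp add: s_def star_simps)
  have "s * s = s" by (subst (1) s_def) (simp add: mult.assoc vs, simp add: s_def)
  then have "projection s" using ss by (simp add: projection_def)
  moreover have "s \<noteq> 0"
    using sv v \<open>c \<noteq> 0\<close> qD(2) by auto
  moreover have "f = 0 \<or> f = s" if f: "projection f" "f * s = f" "s * f = f" for f
  proof -
    define g where "g = (1 / c) *\<^sub>R (star v * f * v)"
    have fvv: "f * (v * (star v * (f * x))) = c *\<^sub>R (f * x)" for x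
    proof -
      have "f * (v * (star v * (f * x))) = c *\<^sub>R (f * s * (f * x))"
        using \<open>c \<noteq> 0\<close> by (simp add: s_def mult.assoc)
      then show ?thesis using f by (simp add: projection_idem_left)
    qed
    have "projection g"
      using f \<open>c \<noteq> 0\<close> by (simp add: projection_def g_def star_simps mult.assoc fvv)
    moreover have "g * q = g" by (simp add: g_def mult.assoc vq)
    moreover have "q * g = g" by (simp add: g_def qv flip: mult.assoc)
    ultimately have "g = 0 \<or> g = q" using qD(6) by blast
    moreover have "f = (1 / c) *\<^sub>R (v * g * star v)"
    proof -
      have "f = s * (f * s)" using f by simp
      also have "\<dots> = (1 / c) *\<^sub>R (v * g * star v)" by (simp add: s_def g_def mult.assoc)
      finally show ?thesis .
    qed
    ultimately show "f = 0 \<or> f = s" by (auto simp: s_def vq)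
  qed
  ultimately show ?thesis unfolding minimal_projection_def s_def by blast
qed

text \<open>
  If \<open>a\<close> does not commute with \<open>q\<close>, then \<open>(1 - q)aq\<close> or the adjoint of \<open>qa(1 - q)\<close> is nonzero and
  can be normalised. Such an element \<open>y\<close> is the matrix unit \<open>E\<^sub>2\<^sub>1\<close> of a \<open>2 \<times> 2\<close> matrix algebra
  with \<open>q = E\<^sub>1\<^sub>1\<close>.
\<close>

lemma noncentral_projection_off_corner:
  assumes q: "minimal_projection q" and "\<not> central q"
  obtains y where "y * q = y" and "q * y = 0" and "star y * y = q"
proof -
  note qD = minimal_projectionD[OF q]
  obtain x where x: "x \<noteq> 0" "x * q = x" "q * x = 0"
  proof -
    obtain a where a: "q * a \<noteq> a * q" using assms(2) by (auto simp: central_def)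
    show thesis
    proof (cases "a * q - q * a * q = 0")
      case True
      have "star (q * a - q * a * q) \<noteq> 0"
      proof
        assume "star (q * a - q * a * q) = 0"
        then have "q * a - q * a * q = 0" by (metis star_star star_0)
        then show False using True a by simp
      qed
      then show thesis
        by (rule that) (simp_all add: star_simps qD algebra_simps)
    next
      case False
      then show thesis
        by (rule that) (simp_all add: qD algebra_simps)
    qed
  qed
  define y where "y = (1 / norm x) *\<^sub>R x"
  show thesis
  proof (rule that)
    show "y * q = y" "q * y = 0" by (simp_all add: y_def x)
    have "norm y = 1" by (simp add: y_def x)
    then show "star y * y = q"
      using star_mult_self_minimal_projection[OF q \<open>y * q = y\<close>] by simp
  qed
qed

text \<open>
  The product \<open>pq\<close> is a projection below both \<open>p\<close> and \<open>q\<close>.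
\<close>

lemma central_minimal_projection_eq:
  assumes p: "minimal_projection p" and q: "minimal_projection q" and "central q" and "p * q \<noteq> 0"
  shows "p = q"
proof -
  note pD = minimal_projectionD[OF p] and qD = minimal_projectionD[OF q]
  have comm: "q * x = x * q" for x using \<open>central q\<close> by (simp add: central_def)
  have "projection (p * q)"
    using pD qD by (simp add: projection_def star_mult comm[of p] mult.assoc)
      (metis comm mult.assoc)
  moreover have "p * q * p = p * q" "p * (p * q) = p * q" "p * q * q = p * q" "q * (p * q) = p * q"
    using comm[of p] by (simp_all add: mult.assoc pD(5) qD(4)) (metis mult.assoc qD(4))
  ultimately show ?thesis using pD(6) qD(6) \<open>p * q \<noteq> 0\<close> by metis
qed

text \<open>
  Distinct central minimal projections are orthogonal, hence linearly independent.
\<close>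

lemma finite_minimal_projections:
  assumes central: "\<And>p. minimal_projection p \<Longrightarrow> central p"
  shows "finite {p. minimal_projection p}"
proof -
  let ?N = "{p. minimal_projection p}"
  have "independent ?N"
  proof
    assume "dependent ?N"
    then obtain S u where S: "finite S" "S \<subseteq> ?N" "(\<Sum>p\<in>S. u p *\<^sub>R p) = 0" "\<exists>p\<in>S. u p \<noteq> 0"
      unfolding dependent_explicit by blast
    obtain p where p: "p \<in> S" "u p \<noteq> 0" using S(4) by blast
    have orth: "p * r = (if r = p then p else 0)" if "r \<in> S" for r
      using that p S(2) central central_minimal_projection_eq[of p r] minimal_projectionD(4)[of p]
      by (cases "p * r = 0") auto
    have "0 = p * (\<Sum>r\<in>S. u r *\<^sub>R r)" using S(3) by simp
    also have "\<dots> = (\<Sum>r\<in>S. if r = p then u p *\<^sub>R p else 0)"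
      unfolding sum_distrib_left by (rule sum.cong) (simp_all add: orth)
    also have "\<dots> = u p *\<^sub>R p" using S(1) p by simp
    finally show False using p S(2) minimal_projectionD(2)[of p] by auto
  qed
  moreover obtain B where "finite B" "span B = (UNIV :: 'a set)" using finite_span by blast
  ultimately show ?thesis using independent_span_bound[of B ?N] by auto
qed

text \<open>
  The sum of all minimal projections is a unit: whatever is orthogonal to all of them
  would otherwise dominate an eigenprojection and thereby another minimal projection.
\<close>

lemma sum_minimal_projections_mult:
  assumes central: "\<And>p. minimal_projection p \<Longrightarrow> central p"
  shows "(\<Sum>p | minimal_projection p. p * x) = x"
proof -
  let ?N = "{p. minimal_projection p}"
  note fin = finite_minimal_projections[OF central]
  define y where "y = x - (\<Sum>p\<in>?N. p * x)"
  have py: "p * y = 0" if p: "minimal_projection p" for p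
  proof -
    have orth: "p * (r * x) = (if r = p then p * x else 0)" if "minimal_projection r" for r
      using that p central central_minimal_projection_eq[of p r] minimal_projectionD(4)[of p]
      by (cases "p * r = 0") (auto simp flip: mult.assoc)
    have "p * (\<Sum>r\<in>?N. r * x) = (\<Sum>r\<in>?N. if r = p then p * x else 0)"
      unfolding sum_distrib_left by (rule sum.cong) (simp_all add: orth)
    also have "\<dots> = p * x" using fin p by simp
    finally show ?thesis by (simp add: y_def right_diff_distrib)
  qed
  have "y = 0"
  proof (rule ccontr)
    assume "y \<noteq> 0"
    then have "star (y * star y) = y * star y" "y * star y \<noteq> 0"
      using star_mult_self_eq_0[of "star y"] by (simp_all add: star_mult) (metis star_star star_0)
    then obtain e c where e: "projection e" "e \<noteq> 0" "c \<noteq> 0" "y * star y * e = c *\<^sub>R e"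
      using exists_eigenprojection by blast
    obtain p where p: "minimal_projection p" "e * p = p"
      using exists_minimal_projection_below[OF e(1,2)] by blast
    have "c *\<^sub>R (p * e) = p * (y * star y * e)" by (simp add: e)
    also have "\<dots> = 0" using py[OF p(1)] by (simp flip: mult.assoc)
    finally have "p * e = 0" using e by simp
    then have "p * (e * p) = 0" by (simp flip: mult.assoc)
    then show False using p minimal_projectionD[OF p(1)] by simp
  qed
  then show ?thesis by (simp add: y_def)
qed

end

section \<open>Which elements are left-symmetric\<close>

text \<open>
  The scalars of \<open>scale\<close> enter only where Birkhoff--James orthogonality does.
\<close>

locale formally_real_cstar_over =
  normed_algebra_over scale + formally_real_cstar star
  for scale :: "'f::real_normed_field \<Rightarrow> 'a::{real_normed_algebra,banach} \<Rightarrow> 'a"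
    and star :: "'a \<Rightarrow> 'a" +
  fixes conj :: "'f \<Rightarrow> 'f"
  assumes star_scale: "star (scale c x) = scale (conj c) (star x)"
begin

lemma bj_orthogonalD: "bj_orthogonal scale v w \<Longrightarrow> norm v \<le> norm (v + scale c w)"
  by (simp add: bj_orthogonal_def)

lemma bj_orthogonal_realD: "bj_orthogonal scale v w \<Longrightarrow> norm v \<le> norm (v + r *\<^sub>R w)"
  using bj_orthogonalD[of v w "of_real r"] by (simp add: scale_of_real)

lemma left_symmetricD:
  "left_symmetric scale v \<Longrightarrow> bj_orthogonal scale v w \<Longrightarrow> bj_orthogonal scale w v"
  by (auto simp: left_symmetric_def right_perp_def left_perp_def)

lemma set_perp_iff: "w \<in> set_perp scale S \<longleftrightarrow> (\<forall>v\<in>S. bj_orthogonal scale v w)"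
  by (auto simp: set_perp_def right_perp_def)

lemma set_perp_set_perp_eq_UNIV_iff:
  "set_perp scale (set_perp scale S) = UNIV \<longleftrightarrow> set_perp scale S \<subseteq> {0}"
proof
  assume "set_perp scale (set_perp scale S) = UNIV"
  then have "bj_orthogonal scale v v" if "v \<in> set_perp scale S" for v
    using that set_perp_iff by blast
  then show "set_perp scale S \<subseteq> {0}"
    using bj_orthogonal_realD[of _ _ "-1"] by fastforce
next
  assume "set_perp scale S \<subseteq> {0}"
  moreover have "bj_orthogonal scale 0 w" for w by (simp add: bj_orthogonal_def)
  ultimately show "set_perp scale (set_perp scale S) = UNIV"
    using set_perp_iff[of _ "set_perp scale S"] by auto
qed

text \<open>
  If \<open>\<parallel>a\<parallel> < \<parallel>b\<parallel>\<close>, then \<open>a + b\<close> is orthogonal to \<open>a\<close>, because \<open>b\<close> alone determines its norm, whereas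
  subtracting a small multiple of \<open>a + b\<close> shrinks \<open>a\<close>. If the norms agree, the witness
  is \<open>2a - b\<close>: of \<open>\<bar>1 + 2c\<bar>\<close> and \<open>\<bar>1 - c\<bar>\<close> at least one is at least \<open>1\<close>, but the norm of \<open>2a - b\<close> is
  determined by \<open>a\<close> alone and drops when a part of \<open>a + b\<close> is subtracted.
\<close>

lemma not_left_symmetric_max_norm_sum_aux:
  assumes "a \<noteq> 0" and le: "norm a \<le> norm b"
    and max_norm: "\<And>s t. norm (scale s a + scale t b) = max (norm s * norm a) (norm t * norm b)"
  shows "\<not> left_symmetric scale (a + b)"
proof
  assume ls: "left_symmetric scale (a + b)"
  have norm_v: "norm (a + b) = norm b" using max_norm[of 1 1] le by simp
  have real: "norm (s *\<^sub>R a + t *\<^sub>R b) = max (\<bar>s\<bar> * norm a) (\<bar>t\<bar> * norm b)" for s t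
    using max_norm[of "of_real s" "of_real t"] by (simp add: scale_of_real)
  show False
  proof (cases "norm a = norm b")
    case False
    have "bj_orthogonal scale (a + b) a"
      unfolding bj_orthogonal_def
    proof
      fix c :: 'f
      have "a + b + scale c a = scale (1 + c) a + scale 1 b"
        by (simp add: scale_left_distrib)
      then show "norm (a + b) \<le> norm (a + b + scale c a)"
        by (simp only: max_norm norm_v) simp
    qed
    then have *: "bj_orthogonal scale a (a + b)" by (rule left_symmetricD[OF ls])
    define \<epsilon> where "\<epsilon> = norm a / (2 * norm b)"
    have b: "norm b > 0" using le \<open>a \<noteq> 0\<close> by (metis order.strict_trans2 zero_less_norm_iff)
    have "norm a < 2 * norm b" using le b by linarith
    then have \<epsilon>: "0 < \<epsilon>" "\<epsilon> < 1" "\<epsilon> * norm b = norm a / 2"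
      using b \<open>a \<noteq> 0\<close> by (simp_all add: \<epsilon>_def)
    have "norm (a + (- \<epsilon>) *\<^sub>R (a + b)) = norm ((1 - \<epsilon>) *\<^sub>R a + (- \<epsilon>) *\<^sub>R b)"
      by (simp add: algebra_simps)
    also have "\<dots> = max ((1 - \<epsilon>) * norm a) (norm a / 2)" unfolding real using \<epsilon> by simp
    also have "\<dots> < norm a" using \<epsilon> \<open>a \<noteq> 0\<close> by (simp add: algebra_simps)
    finally show False using bj_orthogonal_realD[OF *, of "- \<epsilon>"] by simp
  next
    case True
    define w where "w = 2 *\<^sub>R a + (- 1) *\<^sub>R b"
    have w: "w = scale 2 a + scale (- 1) b"
      using scale_of_real[of 2 a] by (simp add: w_def)
    have "bj_orthogonal scale (a + b) w"
      unfolding bj_orthogonal_def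
    proof
      fix c :: 'f
      have "(1 + 2 * c) + 2 * (1 - c) = 3" unfolding right_diff_distrib by simp
      then have "3 = norm ((1 + 2 * c) + 2 * (1 - c))" by simp
      also have "\<dots> \<le> norm (1 + 2 * c) + norm (2 * (1 - c))" by (rule norm_triangle_ineq)
      also have "\<dots> = norm (1 + 2 * c) + 2 * norm (1 - c)" by (simp only: norm_mult norm_numeral)
      finally have "1 \<le> max (norm (1 + 2 * c)) (norm (1 - c))" by linarith
      then have "1 * norm b \<le> max (norm (1 + 2 * c)) (norm (1 - c)) * norm b"
        by (intro mult_right_mono) auto
      also have "\<dots> = max (norm (1 + 2 * c) * norm a) (norm (1 - c) * norm b)"
        by (simp add: True max_mult_distrib_right)
      also have "\<dots> = norm (scale (1 + 2 * c) a + scale (1 - c) b)" by (simp only: max_norm)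
      also have "scale (1 + 2 * c) a + scale (1 - c) b = a + b + scale c w"
        by (simp add: w algebra_simps mult.commute)
      finally show "norm (a + b) \<le> norm (a + b + scale c w)" by (simp add: norm_v)
    qed
    then have *: "bj_orthogonal scale w (a + b)" by (rule left_symmetricD[OF ls])
    have "w + (- 1 / 2) *\<^sub>R (a + b) = (2 - 1 / 2) *\<^sub>R a + (- 1 - 1 / 2) *\<^sub>R b"
      unfolding w_def scaleR_left_diff_distrib by (simp add: algebra_simps)
    then have "norm (w + (- 1 / 2) *\<^sub>R (a + b)) = norm ((2 - 1 / 2) *\<^sub>R a + (- 1 - 1 / 2) *\<^sub>R b)"
      by (rule arg_cong)
    also have "\<dots> = 3 / 2 * norm a" unfolding real by (simp add: True)
    finally have "norm (w + (- 1 / 2) *\<^sub>R (a + b)) = 3 / 2 * norm a" .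
    moreover have "norm w = 2 * norm a" unfolding w_def real by (simp add: True)
    moreover have "norm a > 0" using \<open>a \<noteq> 0\<close> by simp
    ultimately show False using bj_orthogonal_realD[OF *, of "- 1 / 2"] by linarith
  qed
qed

lemma not_left_symmetric_max_norm_sum:
  assumes "a \<noteq> 0" and "b \<noteq> 0"
    and max_norm: "\<And>s t. norm (scale s a + scale t b) = max (norm s * norm a) (norm t * norm b)"
  shows "\<not> left_symmetric scale (a + b)"
proof (cases "norm a \<le> norm b")
  case True
  then show ?thesis using assms not_left_symmetric_max_norm_sum_aux by blast
next
  case False
  have "norm (scale s b + scale t a) = max (norm s * norm b) (norm t * norm a)" for s t
    using max_norm[of t s] by (simp add: add.commute max.commute)
  then have "\<not> left_symmetric scale (b + a)"
    using not_left_symmetric_max_norm_sum_aux[of b a] assms(2) False by simp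
  then show ?thesis by (simp add: add.commute)
qed

text \<open>
  When \<open>e\<close> commutes with \<open>v\<^sup>*v\<close>, the elements \<open>ve\<close> and \<open>v(1 - e)\<close> have orthogonal ranges and
  orthogonal supports, so they form a splitting with maximum norm.
\<close>

lemma left_symmetric_projection_cases:
  assumes ls: "left_symmetric scale v" and e: "projection e"
    and comm: "star v * v * e = e * (star v * v)"
  shows "v * e = 0 \<or> v * e = v"
proof (rule ccontr)
  assume *: "\<not> (v * e = 0 \<or> v * e = v)"
  define a b where "a = v * e" and "b = v - v * e"
  note eD = projection_star[OF e] projection_idem[OF e] projection_idem_left[OF e]
  have ab: "star a * b = 0"
    using comm by (simp add: a_def b_def star_simps eD right_diff_distrib mult.assoc)
  have ab': "a * star b = 0"
    by (simp add: a_def b_def star_simps eD right_diff_distrib mult.assoc)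
  have "norm (scale s a + scale t b) = max (norm s * norm a) (norm t * norm b)" for s t
  proof (rule antisym)
    have st: "star (scale s a) * scale t b = 0" "scale s a * star (scale t b) = 0"
      by (simp_all add: star_scale mult_scale_left mult_scale_right ab ab')
    show "norm (scale s a + scale t b) \<le> max (norm s * norm a) (norm t * norm b)"
      using norm_add_orthogonal_le[OF st] by (simp add: norm_scale)
  next
    have "(scale s a + scale t b) * e = scale s a"
      by (simp add: a_def b_def mult_scale_left distrib_right left_diff_distrib mult.assoc eD)
    moreover from this have "scale s a + scale t b - (scale s a + scale t b) * e = scale t b" by simp
    ultimately have "norm (scale s a) \<le> norm (scale s a + scale t b)"
      "norm (scale t b) \<le> norm (scale s a + scale t b)"
      using norm_mult_projection_le[OF e] norm_mult_complement_le[OF e] by metis+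
    then show "max (norm s * norm a) (norm t * norm b) \<le> norm (scale s a + scale t b)"
      by (simp add: norm_scale)
  qed
  moreover have "a \<noteq> 0" "b \<noteq> 0" using * by (auto simp: a_def b_def)
  ultimately have "\<not> left_symmetric scale (a + b)"
    using not_left_symmetric_max_norm_sum by blast
  then show False using ls by (simp add: a_def b_def)
qed

text \<open>
  Take an eigenprojection \<open>e\<close> of \<open>v\<^sup>*v\<close>. Every projection below \<open>e\<close> commutes with \<open>v\<^sup>*v\<close> and therefore
  supports either nothing or all of \<open>v\<close>. So \<open>e\<close> itself supports \<open>v\<close>, and nothing nonzero lies
  properly below \<open>e\<close>.
\<close>

lemma left_symmetric_minimal_support:
  assumes ls: "left_symmetric scale v" and "v \<noteq> 0"
  obtains c q where "c > 0" and "minimal_projection q" and "star v * v = c *\<^sub>R q" and "v * q = v"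
proof -
  define h where "h = star v * v"
  have "star h = h" and "h \<noteq> 0" using \<open>v \<noteq> 0\<close> by (simp_all add: h_def star_mult)
  then obtain e c where e: "projection e" "e \<noteq> 0" "c \<noteq> 0" "h * e = c *\<^sub>R e" "e * h = c *\<^sub>R e"
    using exists_eigenprojection by blast
  have support: "v * f = v" if f: "projection f" "f \<noteq> 0" "h * f = c *\<^sub>R f" "f * h = c *\<^sub>R f" for f
  proof -
    have "v * f \<noteq> 0"
    proof
      assume "v * f = 0"
      then have "h * f = 0" by (simp add: h_def mult.assoc)
      then show False using f \<open>c \<noteq> 0\<close> by simp
    qed
    then show ?thesis
      using left_symmetric_projection_cases[OF ls f(1)] f by (auto simp: h_def)
  qed
  have ve: "v * e = v" using support e by blast
  then have "h * e = h" by (simp add: h_def mult.assoc)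
  then have h: "h = c *\<^sub>R e" using e by simp
  have "minimal_projection e"
    unfolding minimal_projection_def
  proof (intro conjI allI impI)
    fix f assume f: "projection f \<and> f * e = f \<and> e * f = f"
    show "f = 0 \<or> f = e"
    proof (cases "f = 0")
      case False
      have "v * f = v" using f False by (intro support) (simp_all add: h)
      then have "h * f = h" by (simp add: h_def mult.assoc)
      then show ?thesis using f \<open>c \<noteq> 0\<close> by (simp add: h)
    qed simp
  qed (use e in auto)
  moreover from this have "c *\<^sub>R e = (norm v)\<^sup>2 *\<^sub>R e"
    using star_mult_self_minimal_projection[OF _ ve] h unfolding h_def by metis
  then have "c = (norm v)\<^sup>2" using e by simp
  then have "c > 0" using \<open>v \<noteq> 0\<close> by simp
  ultimately show thesis using that h ve by (simp add: h_def)
qed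

text \<open>
  Let \<open>s\<close> be the range projection of \<open>v\<close>, and let \<open>y\<close> and \<open>z\<close> be off-diagonal elements at \<open>q\<close> and
  \<open>s\<close>. With \<open>r = yy\<^sup>*\<close>, the elements \<open>q, y\<^sup>*, y, r\<close> are \<open>2 \<times> 2\<close> matrix units, and \<open>V = v + zvy\<^sup>*\<close> is a
  multiple of a partial isometry with support \<open>q + r\<close> and \<open>Vq = v\<close>, so that left multiplication
  by \<open>V\<close> scales norms on \<open>2 \<times> 2\<close> matrices and turns \<open>E\<^sub>1\<^sub>1\<close> into \<open>v\<close>. The witness is \<open>w = VW\<close>, where
  \<open>W\<close> has rows \<open>0, 2\<close> and \<open>2, 3\<close>. The entry \<open>0\<close> gives \<open>v \<bottom> w\<close>. The norm of \<open>W\<close> is \<open>4\<close> and is attained at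
  the vector \<open>(1, 2)\<close>, on which \<open>E\<^sub>1\<^sub>1\<close> does not vanish, and \<open>W - E\<^sub>1\<^sub>1\<close> has norm less than \<open>4\<close>.
\<close>

lemma not_left_symmetric_noncentral_support:
  assumes q: "minimal_projection q" and nc: "\<not> central q"
    and c: "c > 0" and v: "star v * v = c *\<^sub>R q" and vq: "v * q = v"
  shows "\<not> left_symmetric scale v"
proof
  assume ls: "left_symmetric scale v"
  note qD = minimal_projectionD[OF q]
  define s where "s = (1 / c) *\<^sub>R (v * star v)"
  have s: "minimal_projection s"
    unfolding s_def using minimal_projection_transfer[OF q vq v] c by simp
  note sD = minimal_projectionD[OF s]
  have sv: "s * v = v" using c by (simp add: s_def mult.assoc v vq)
  have "star v * s = star v" using sv star_mult[of s v] sD by simp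
  \<comment> \<open>A central \<open>s\<close> would lie above \<open>q\<close> and, by minimality, coincide with it.\<close>
  have "\<not> central s"
  proof
    assume "central s"
    have "q * s = q"
    proof -
      have "c *\<^sub>R (q * s) = star v * (v * s)" by (simp add: v flip: mult.assoc)
      also have "v * s = v" using \<open>central s\<close> sv by (simp add: central_def)
      finally show ?thesis using c by (simp add: v)
    qed
    then have "q = s" using central_minimal_projection_eq[OF q s \<open>central s\<close>] qD by simp
    then show False using nc \<open>central s\<close> by simp
  qed
  obtain y where y: "y * q = y" "q * y = 0" "star y * y = q"
    using noncentral_projection_off_corner[OF q nc] by blast
  obtain z where z: "z * s = z" "s * z = 0" "star z * z = s"
    using noncentral_projection_off_corner[OF s \<open>\<not> central s\<close>] by blast
  have yy: "y * y = 0" using y by (metis mult.assoc mult_zero_right)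
  have syq: "star y * q = 0" "q * star y = star y"
    using star_mult[of q y] star_mult[of y q] y qD by simp_all
  have yy': "star y * star y = 0" using star_mult[of y y] yy by simp
  have yyy: "y * (star y * y) = y" "star y * (y * star y) = star y"
    using y syq by (simp, simp flip: mult.assoc)
  define r where "r = y * star y"
  have r: "r * r = r" "q * r = 0" "r * q = 0" "star r = r" "r * y = y" "star y * r = star y"
    "y * r = 0" "r * star y = 0"
    using y yyy syq yy yy' by (simp_all add: r_def star_mult mult.assoc)
       (simp_all flip: mult.assoc)
  define V where "V = v + z * v * star y"
  have vz: "star v * z = 0" using \<open>star v * s = star v\<close> z by (metis mult.assoc mult_zero_right)
  have zv: "star z * v = 0" using vz star_mult[of "star v" z] by simp
  have VV: "star V * V = c *\<^sub>R (q + r)"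
  proof -
    have "star V * V = star v * v + star v * z * v * star y + y * star v * (star z * v) 
        + y * star v * (star z * z) * v * star y"
      by (simp add: V_def star_simps algebra_simps)
    also have "y * star v * (star z * z) * v * star y = y * (star v * v) * star y"
      using z sv by (simp add: mult.assoc)
    finally show ?thesis
      by (simp add: vz zv v r_def y scaleR_add_right)
  qed
  have norm_V: "norm (V * x) = sqrt c * norm x" if "q * x + r * x = x" for x
  proof -
    have "star (V * x) * (V * x) = star x * (star V * V) * x" by (simp add: star_mult mult.assoc)
    also have "\<dots> = c *\<^sub>R (star x * (q * x + r * x))" by (simp add: VV algebra_simps mult.assoc)
    finally have "(norm (V * x))\<^sup>2 = c * (norm x)\<^sup>2"
      using cstar_identity[of "V * x"] cstar_identity[of x] c by (simp add: that)
    then show ?thesis by (metis norm_ge_zero real_sqrt_abs2 real_sqrt_mult real_sqrt_unique power2_eq_square abs_norm_cancel)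
  qed
  have Vq: "V * q = v" by (simp add: V_def distrib_right mult.assoc vq syq)
  define W where "W = 2 *\<^sub>R y + 2 *\<^sub>R star y + 3 *\<^sub>R r"
  define X where "X = q + 2 *\<^sub>R y"
  define w where "w = V * W"
  have norm_W: "norm W \<ge> 4"
  proof -
    \<comment> \<open>\<open>X\<close> is the matrix with first column \<open>(1, 2)\<close>, an eigenvector of \<open>W\<close>.\<close>
    have "W * X = 4 *\<^sub>R X"
      by (simp add: W_def X_def algebra_simps yy syq r y) (simp flip: scaleR_left_distrib)
    then have "4 * norm X \<le> norm W * norm X" using norm_mult_ineq[of W X] by simp
    moreover have "X \<noteq> 0"
    proof
      assume "X = 0"
      then have "q * X = 0" by simp
      then show False using qD by (simp add: X_def distrib_left y)
    qed
    ultimately show ?thesis by simp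
  qed
  have norm_T: "norm (W - q) < 4"
  proof -
    \<comment> \<open>\<open>T\<close> has trace \<open>2\<close> and determinant \<open>-7\<close>, so \<open>T\<^sup>2 = 2T + 7\<close> by Cayley--Hamilton.\<close>
    define T where "T = W - q"
    have coeffs: "6 *\<^sub>R x = 2 *\<^sub>R x + 4 *\<^sub>R x" "7 *\<^sub>R x = 1 *\<^sub>R x + 2 *\<^sub>R x + 4 *\<^sub>R x"
      "9 *\<^sub>R x = 2 *\<^sub>R x + 7 *\<^sub>R x" for x :: 'a
      by (simp_all only: scaleR_left_distrib[symmetric]) simp_all
    have "T * T = 2 *\<^sub>R T + 7 *\<^sub>R (q + r)"
      by (simp add: T_def W_def algebra_simps yy yy' syq r y qD r_def[symmetric])
        (simp add: coeffs algebra_simps)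
    moreover have "star T = T" by (simp add: T_def W_def star_simps qD r algebra_simps)
    ultimately have "(norm T)\<^sup>2 = norm (2 *\<^sub>R T + 7 *\<^sub>R (q + r))"
      using cstar_identity[of T] by simp
    also have "\<dots> \<le> 2 * norm T + 7 * norm (q + r)"
      using norm_triangle_ineq[of "2 *\<^sub>R T" "7 *\<^sub>R (q + r)"] by simp
    also have "norm (q + r) \<le> 1"
      by (rule norm_projection_le) (simp add: projection_def star_simps qD r algebra_simps)
    finally have "norm T * norm T \<le> 2 * norm T + 7" by (simp add: power2_eq_square)
    moreover have "2 * norm T + 7 < norm T * norm T" if "norm T \<ge> 4"
      using mult_right_mono[OF that, of "norm T"] that by simp
    ultimately show ?thesis unfolding T_def by force
  qed
  have "bj_orthogonal scale v w"
    unfolding bj_orthogonal_def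
  proof
    fix d
    have "v * y = 0" using vq y by (metis mult.assoc mult_zero_right)
    then have "w * q = 2 *\<^sub>R (z * v)"
      by (simp add: w_def W_def V_def algebra_simps y syq r mult.assoc vq)
    then have "star v * (w * q) = 0" by (simp add: vz flip: mult.assoc)
    then have "star v * (v + scale d w) * q = c *\<^sub>R q"
      by (simp add: v qD distrib_left distrib_right mult_scale_left mult_scale_right mult.assoc vq)
    then have "c = norm (star v * (v + scale d w) * q)"
      using c norm_projection[OF qD(1,2)] by simp
    also have "\<dots> \<le> norm (star v * (v + scale d w))" by (rule norm_mult_projection_le[OF qD(1)])
    also have "\<dots> \<le> norm v * norm (v + scale d w)"
      using norm_mult_ineq[of "star v" "v + scale d w"] by simp
    finally have "(norm v)\<^sup>2 \<le> norm v * norm (v + scale d w)"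
      using cstar_identity[of v] norm_projection[OF qD(1,2)] c by (simp add: v)
    moreover have "norm v > 0" using v c qD(2) by auto
    ultimately show "norm v \<le> norm (v + scale d w)" by (simp add: power2_eq_square)
  qed
  then have *: "bj_orthogonal scale w v" by (rule left_symmetricD[OF ls])
  have "w - v = V * (W - q)" by (simp add: w_def Vq right_diff_distrib)
  moreover have "q * (W - q) + r * (W - q) = W - q" "q * W + r * W = W"
    by (simp_all add: W_def algebra_simps y syq r qD)
  ultimately have "norm (w - v) < norm w"
    using norm_W norm_T c by (simp add: norm_V w_def)
  then show False using bj_orthogonal_realD[OF *, of "- 1"] by simp
qed

section \<open>Pseudo-abelian algebras\<close>

text \<open>
  A left-symmetric \<open>v\<close> is supported by a central minimal projection, which is orthogonal to \<open>p\<close>.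
  So \<open>vp = 0\<close>, and \<open>v\<close> is recovered from \<open>v + cp\<close> by the contraction \<open>x \<mapsto> x(1 - p)\<close>.
\<close>

lemma noncentral_minimal_projection_in_perp:
  assumes p: "minimal_projection p" and nc: "\<not> central p"
  shows "p \<in> set_perp scale (left_symmetric_set scale)"
  unfolding set_perp_iff left_symmetric_set_def
proof clarify
  fix v assume ls: "left_symmetric scale v"
  note pD = minimal_projectionD[OF p]
  have "v * p = 0"
  proof (rule ccontr)
    assume "v * p \<noteq> 0"
    then have "v \<noteq> 0" by auto
    then obtain c q where q: "c > 0" "minimal_projection q" "star v * v = c *\<^sub>R q" "v * q = v"
      using left_symmetric_minimal_support[OF ls] by blast
    have "central q"
      using not_left_symmetric_noncentral_support[OF q(2) _ q(1,3,4)] ls by blast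
    moreover have "p * q \<noteq> 0"
    proof
      assume "p * q = 0"
      then have "q * p = 0" using \<open>central q\<close> by (simp add: central_def)
      then have "v * q * p = 0" by (simp add: mult.assoc)
      then show False using q \<open>v * p \<noteq> 0\<close> by simp
    qed
    ultimately show False using central_minimal_projection_eq[OF p q(2)] nc by simp
  qed
  show "bj_orthogonal scale v p"
    unfolding bj_orthogonal_def
  proof
    fix c
    have "v + scale c p - (v + scale c p) * p = v"
      using \<open>v * p = 0\<close> by (simp add: distrib_right mult_scale_left pD)
    then show "norm v \<le> norm (v + scale c p)"
      using norm_mult_complement_le[OF pD(1), of "v + scale c p"] by simp
  qed
qed

text \<open>
  In the corner of \<open>p\<close> both \<open>x\<^sup>*x\<close> and \<open>xx\<^sup>*\<close> are nonzero multiples of \<open>p\<close> for \<open>x \<noteq> 0\<close>, so a multiple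
  of \<open>x\<^sup>*\<close> is the inverse of \<open>x\<close>.
\<close>

lemma central_minimal_projection_ideal:
  assumes p: "minimal_projection p" and "central p"
  shows "minimal_ideal scale (range (\<lambda>x. p * x))" and "is_skew_field (range (\<lambda>x. p * x))"
proof -
  let ?I = "range (\<lambda>x. p * x)"
  note pD = minimal_projectionD[OF p]
  have comm: "p * x = x * p" for x using \<open>central p\<close> by (simp add: central_def)
  have mem: "x \<in> ?I \<longleftrightarrow> p * x = x" for x using pD by (metis rangeE rangeI)
  have p_mult: "p * (x * y) = x * (p * y)" for x y by (metis comm mult.assoc)
  have inv: "\<exists>y\<in>?I. x * y = p \<and> y * x = p" if "x \<in> ?I" "x \<noteq> 0" for x
  proof -
    have px: "p * x = x" "x * p = x" using that mem comm by metis+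
    have "p * star x = star x" using star_mult[of x p] px pD by simp
    then have sx: "p * star x = star x" "star x * p = star x" using comm by metis+
    define n where "n = (norm x)\<^sup>2"
    have "n \<noteq> 0" using that by (simp add: n_def)
    have "star x * x = n *\<^sub>R p" "x * star x = n *\<^sub>R p"
      using star_mult_self_minimal_projection[OF p px(2)]
        star_mult_self_minimal_projection[OF p sx(2)] by (simp_all add: n_def)
    then have "x * ((1 / n) *\<^sub>R star x) = p" "((1 / n) *\<^sub>R star x) * x = p"
      using \<open>n \<noteq> 0\<close> by simp_all
    moreover have "(1 / n) *\<^sub>R star x \<in> ?I" by (simp add: mem sx)
    ultimately show ?thesis by blast
  qed
  show "is_skew_field ?I"
    unfolding is_skew_field_def
  proof (rule bexI[of _ p]; (intro conjI ballI impI)?)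
    show "p \<in> ?I" "p \<noteq> 0" using pD mem by simp_all
    show "p * x = x" "x * p = x" if "x \<in> ?I" for x using that mem comm by metis+
  qed (rule inv)
  have sub: "module.subspace scale ?I"
  proof (rule subspaceI)
    show "0 \<in> ?I" by (simp add: mem)
    show "x + y \<in> ?I" if "x \<in> ?I" "y \<in> ?I" for x y using that by (simp only: mem distrib_left)
    show "scale c x \<in> ?I" if "x \<in> ?I" for c x using that by (simp only: mem mult_scale_right)
  qed
  show "minimal_ideal scale ?I"
    unfolding minimal_ideal_def two_sided_ideal_def
  proof (intro conjI allI impI ballI sub)
    fix x a assume "x \<in> ?I"
    then show "a * x \<in> ?I" "x * a \<in> ?I"
      unfolding mem using p_mult by (metis, metis mult.assoc)
  next
    show "?I \<noteq> {0}" using pD mem by (metis singletonD)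
  next
    fix J assume J: "(module.subspace scale J \<and> (\<forall>x\<in>J. \<forall>a. a * x \<in> J \<and> x * a \<in> J)) \<and> J \<subseteq> ?I"
    show "J = {0} \<or> J = ?I"
    proof (rule disjCI)
      assume "J \<noteq> ?I"
      have "x = 0" if "x \<in> J" for x
      proof (rule ccontr)
        assume "x \<noteq> 0"
        then obtain y where "x * y = p" using inv J \<open>x \<in> J\<close> by blast
        then have "p \<in> J" using J \<open>x \<in> J\<close> by blast
        then have "?I \<subseteq> J" using J by blast
        then show False using J \<open>J \<noteq> ?I\<close> by blast
      qed
      moreover have "0 \<in> J" using J subspace_0 by blast
      ultimately show "J = {0}" by blast
    qed
  qed
qed

lemma pseudo_abelian_if_minimal_projections_central:
  assumes central: "\<And>p. minimal_projection p \<Longrightarrow> central p"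
  shows "pseudo_abelian scale"
proof -
  let ?U = "\<Union>{I. minimal_ideal scale I \<and> is_skew_field I}"
  have "x \<in> module.span scale ?U" for x
  proof -
    have "p * x \<in> module.span scale ?U" if "minimal_projection p" for p
    proof (rule span_base)
      show "p * x \<in> ?U"
        using central_minimal_projection_ideal[OF that central[OF that]] by blast
    qed
    then have "(\<Sum>p | minimal_projection p. p * x) \<in> module.span scale ?U"
      by (intro span_sum) simp
    then show ?thesis by (simp only: sum_minimal_projections_mult[OF central])
  qed
  then show ?thesis by (auto simp: pseudo_abelian_def)
qed

text \<open>
  A skew-field has no idempotents besides \<open>0\<close> and its unit \<open>e\<close>. Since \<open>e\<close> is central, \<open>e\<^sup>*e\<close> is a
  nonzero idempotent of the ideal, so \<open>e\<^sup>*e = e\<close> and \<open>e\<close> is self-adjoint.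
\<close>

lemma skew_field_ideal_unit:
  assumes "two_sided_ideal scale I" and "is_skew_field I"
  obtains e where "minimal_projection e" and "central e" and "I = range (\<lambda>x. e * x)"
proof -
  obtain e where e: "e \<in> I" "e \<noteq> 0" "\<And>x. x \<in> I \<Longrightarrow> e * x = x" "\<And>x. x \<in> I \<Longrightarrow> x * e = x"
    and inv: "\<And>x. x \<in> I \<Longrightarrow> x \<noteq> 0 \<Longrightarrow> \<exists>y\<in>I. x * y = e \<and> y * x = e"
    using assms(2) unfolding is_skew_field_def by blast
  have ideal: "a * x \<in> I" "x * a \<in> I" if "x \<in> I" for a x
    using assms(1) that unfolding two_sided_ideal_def by blast+
  have comm: "e * x = x * e" for x
    using e ideal by (metis mult.assoc)
  then have "central e" by (simp add: central_def)
  have idem: "f = e" if "f \<in> I" "f * f = f" "f \<noteq> 0" for f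
    using inv[OF that(1,3)] that e by (metis mult.assoc)
  have "star e * e = e"
  proof (rule idem)
    show "star e * e \<in> I" using ideal e by blast
    show "star e * e \<noteq> 0" using e by simp
    have "star e * star e = star e" using star_mult[of e e] e by simp
    then have "star e * (e * star e) * e = star e * e"
      using comm[of "star e"] e by (metis mult.assoc)
    then show "star e * e * (star e * e) = star e * e" by (simp add: mult.assoc)
  qed
  then have "star e = e" using star_mult[of "star e" e] by simp
  then have "projection e" using e by (simp add: projection_def)
  have "minimal_projection e"
    unfolding minimal_projection_def
  proof (intro conjI allI impI)
    fix f assume f: "projection f \<and> f * e = f \<and> e * f = f"
    then have "f \<in> I" using ideal e by metis
    then show "f = 0 \<or> f = e" using idem f projection_idem by blast
  qed (use e \<open>projection e\<close> in auto)
  moreover have "x \<in> range (\<lambda>x. e * x)" if "x \<in> I" for x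
    using e(3)[OF that] by (metis rangeI)
  then have "I = range (\<lambda>x. e * x)" using e(1) ideal by blast
  ultimately show thesis using that \<open>central e\<close> by blast
qed

text \<open>
  By \<open>x\<^sup>*x = \<parallel>x\<parallel>\<^sup>2 e\<close> the norm on the left ideal of \<open>e\<close> comes from a real inner product. If \<open>x\<close> has locally
  least norm on the real line through \<open>x\<close> in each direction \<open>cy\<close>, then \<open>x\<close> is orthogonal to all of
  these directions in the Euclidean sense, and the theorem of Pythagoras gives the converse
  orthogonality. The hypothesis is local because the norm of an element outside the
  ideal only controls its part in the ideal for small perturbations.
\<close>

lemma bj_orthogonal_sym_minimal_corner:
  assumes e: "minimal_projection e" and xe: "x * e = x" and ye: "y * e = y"
    and local: "\<And>c. \<exists>\<delta>>0. \<forall>t. \<bar>t\<bar> < \<delta> \<longrightarrow> norm x \<le> norm (x + t *\<^sub>R scale c y)"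
  shows "bj_orthogonal scale y x"
proof -
  note eD = minimal_projectionD[OF e]
  have norm_e: "norm e = 1" using norm_projection eD by blast
  have quad: "\<exists>b. \<forall>t. (norm (u + t *\<^sub>R w))\<^sup>2 = (norm u)\<^sup>2 + 2 * t * b + t\<^sup>2 * (norm w)\<^sup>2"
    if u: "u * e = u" and w: "w * e = w" for u w
  proof -
    have "star (star u * w + star w * u) = star u * w + star w * u"
      "(star u * w + star w * u) * e = star u * w + star w * u"
      by (simp_all add: star_simps distrib_right mult.assoc u w)
    then obtain b where b: "star u * w + star w * u = b *\<^sub>R e"
      using minimal_projection_corner_self_adjoint[OF e] by blast
    have "(norm (u + t *\<^sub>R w))\<^sup>2 = (norm u)\<^sup>2 + 2 * t * (b / 2) + t\<^sup>2 * (norm w)\<^sup>2" for t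
    proof -
      have "star (u + t *\<^sub>R w) * (u + t *\<^sub>R w)
          = star u * u + t *\<^sub>R (star u * w + star w * u) + (t * t) *\<^sub>R (star w * w)"
        by (simp add: star_simps algebra_simps)
      also have "\<dots> = ((norm u)\<^sup>2 + t * b + t * t * (norm w)\<^sup>2) *\<^sub>R e"
        by (simp add: b star_mult_self_minimal_projection[OF e] u w scaleR_add_left)
      finally have "(norm (u + t *\<^sub>R w))\<^sup>2 *\<^sub>R e = ((norm u)\<^sup>2 + t * b + t * t * (norm w)\<^sup>2) *\<^sub>R e"
        by (subst star_mult_self_minimal_projection[OF e, symmetric])
          (simp_all add: distrib_right u w)
      then show ?thesis using eD(2) by (simp add: power2_eq_square)
    qed
    then show ?thesis by blast
  qed
  have pyth: "(norm (x + scale c y))\<^sup>2 = (norm x)\<^sup>2 + (norm (scale c y))\<^sup>2" for c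
  proof -
    have "scale c y * e = scale c y" by (simp add: mult_scale_left ye)
    then obtain b where b: "\<And>t. (norm (x + t *\<^sub>R scale c y))\<^sup>2
        = (norm x)\<^sup>2 + 2 * t * b + t\<^sup>2 * (norm (scale c y))\<^sup>2"
      using quad[OF xe] by blast
    define n where "n = (norm (scale c y))\<^sup>2"
    obtain \<delta> where \<delta>: "\<delta> > 0" "\<And>t. \<bar>t\<bar> < \<delta> \<Longrightarrow> norm x \<le> norm (x + t *\<^sub>R scale c y)"
      using local by blast
    have "b = 0"
    proof (rule ccontr)
      assume "b \<noteq> 0"
      \<comment> \<open>A step of size \<open>s\<close> against the sign of \<open>b\<close> would decrease the norm.\<close>
      define s where "s = min (\<delta> / 2) (\<bar>b\<bar> / (n + 1))"
      have n: "n \<ge> 0" by (simp add: n_def)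
      have s: "s > 0" "s < \<delta>" using \<delta> \<open>b \<noteq> 0\<close> n by (simp_all add: s_def min_less_iff_disj)
      have "s * n < 2 * \<bar>b\<bar>"
      proof -
        have "s \<le> \<bar>b\<bar> / (n + 1)" by (simp add: s_def)
        then have "s * (n + 1) \<le> \<bar>b\<bar>" using n by (simp add: le_divide_eq)
        moreover have "s * n \<le> s * (n + 1)" using s by simp
        ultimately show ?thesis using \<open>b \<noteq> 0\<close> by linarith
      qed
      define t where "t = - sgn b * s"
      have "\<bar>t\<bar> = s" using s \<open>b \<noteq> 0\<close> by (simp add: t_def abs_mult)
      then have "(norm x)\<^sup>2 \<le> (norm (x + t *\<^sub>R scale c y))\<^sup>2"
        using \<delta>(2)[of t] s by (simp add: power_mono)
      then have "0 \<le> 2 * (t * b) + t\<^sup>2 * n" using b[of t] by (simp add: n_def)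
      moreover have "t * b = - (s * \<bar>b\<bar>)" by (simp add: t_def abs_sgn)
      moreover have "t\<^sup>2 = s * s" using \<open>\<bar>t\<bar> = s\<close> by (metis power2_abs power2_eq_square)
      ultimately have "s * (2 * \<bar>b\<bar>) \<le> s * (s * n)" by (simp only: algebra_simps)
      then show False using s \<open>s * n < 2 * \<bar>b\<bar>\<close> by simp
    qed
    then show ?thesis using b[of 1] by simp
  qed
  show ?thesis
    unfolding bj_orthogonal_def
  proof
    fix c
    show "norm y \<le> norm (y + scale c x)"
    proof (cases "c = 0")
      case False
      have "y + scale c x = scale c (x + scale (inverse c) y)"
        using False by (simp add: scale_right_distrib)
      then have "norm (y + scale c x) = norm c * norm (x + scale (inverse c) y)"
        by (simp add: norm_scale)
      moreover have "norm (scale (inverse c) y) \<le> norm (x + scale (inverse c) y)"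
        by (rule power2_le_imp_le) (simp_all add: pyth)
      then have "norm c * norm (scale (inverse c) y) \<le> norm c * norm (x + scale (inverse c) y)"
        by (intro mult_left_mono) auto
      moreover have "norm c * norm (scale (inverse c) y) = norm y"
        using False by (simp add: norm_scale norm_inverse)
      ultimately show ?thesis by simp
    qed simp
  qed
qed

text \<open>
  Since \<open>e\<close> is central, \<open>ex\<close> and \<open>x - ex\<close> have orthogonal ranges and orthogonal supports.
\<close>

lemma norm_central_split:
  assumes e: "projection e" and "central e"
  shows "norm x = max (norm (e * x)) (norm (x - e * x))"
proof (rule antisym)
  note eD = projection_star[OF e] projection_idem[OF e] projection_idem_left[OF e]
  have comm: "e * y = y * e" for y using \<open>central e\<close> by (simp add: central_def)
  have "star (e * x) * (x - e * x) = 0"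
    by (simp add: star_simps eD right_diff_distrib mult.assoc)
  moreover have "e * x * star (x - e * x) = 0"
  proof -
    have "e * x * star (x - e * x) = e * (x * star x) - e * (x * star x) * e"
      by (simp add: star_simps eD right_diff_distrib mult.assoc)
    then show ?thesis by (simp add: comm[symmetric] eD)
  qed
  ultimately show "norm x \<le> max (norm (e * x)) (norm (x - e * x))"
    using norm_add_orthogonal_le[of "e * x" "x - e * x"] by simp
  show "max (norm (e * x)) (norm (x - e * x)) \<le> norm x"
    using norm_mult_projection_le[OF e, of x] norm_mult_complement_le[OF e, of x]
    by (simp add: comm)
qed

text \<open>
  If \<open>a \<bottom> w\<close>, then for small scalars the norm of \<open>a + cw\<close> is attained by its part under \<open>e\<close>. So \<open>a\<close> is
  locally of least norm in the direction of \<open>ew\<close>, which yields \<open>ew \<bottom> a\<close> inside the ideal; adding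
  the unchanged part of \<open>w\<close> under the complement of \<open>e\<close> gives \<open>w \<bottom> a\<close>.
\<close>

lemma left_symmetric_central_corner:
  assumes e: "minimal_projection e" and "central e" and ae: "e * a = a"
  shows "left_symmetric scale a"
  unfolding left_symmetric_def right_perp_def left_perp_def
proof clarify
  fix w assume aw: "bj_orthogonal scale a w"
  note eD = minimal_projectionD[OF e]
  note split = norm_central_split[OF eD(1) \<open>central e\<close>]
  have comm: "e * y = y * e" for y using \<open>central e\<close> by (simp add: central_def)
  show "bj_orthogonal scale w a"
  proof (cases "a = 0")
    case True
    then show ?thesis by (simp add: bj_orthogonal_def)
  next
    case False
    have "bj_orthogonal scale (e * w) a"
    proof (rule bj_orthogonal_sym_minimal_corner[OF e])
      show "a * e = a" "e * w * e = e * w" using ae comm eD by (metis, metis)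
      fix c
      define z where "z = scale c w"
      define \<delta> where "\<delta> = norm a / (norm (z - e * z) + 1)"
      have "\<delta> > 0" using False by (simp add: \<delta>_def add_nonneg_pos)
      moreover have "norm a \<le> norm (a + t *\<^sub>R scale c (e * w))" if "\<bar>t\<bar> < \<delta>" for t
      proof -
        have "a + t *\<^sub>R z = a + scale (of_real t * c) w"
          using scale_of_real[of t z] by (simp add: z_def)
        then have "norm a \<le> norm (a + t *\<^sub>R z)" using bj_orthogonalD[OF aw] by metis
        moreover have "e * (a + t *\<^sub>R z) = a + t *\<^sub>R scale c (e * w)"
          by (simp add: distrib_left ae z_def mult_scale_right)
        moreover have "norm (a + t *\<^sub>R z - e * (a + t *\<^sub>R z)) < norm a"
        proof -
          have "a + t *\<^sub>R z - e * (a + t *\<^sub>R z) = t *\<^sub>R (z - e * z)"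
            by (simp add: distrib_left ae scaleR_diff_right)
          then have "norm (a + t *\<^sub>R z - e * (a + t *\<^sub>R z)) \<le> \<bar>t\<bar> * (norm (z - e * z) + 1)"
            by (simp add: mult_left_mono)
          also have "\<dots> < norm a"
            using that by (simp add: \<delta>_def pos_less_divide_eq add_nonneg_pos)
          finally show ?thesis .
        qed
        ultimately show ?thesis using split[of "a + t *\<^sub>R z"] by simp
      qed
      ultimately show "\<exists>\<delta>>0. \<forall>t. \<bar>t\<bar> < \<delta> \<longrightarrow> norm a \<le> norm (a + t *\<^sub>R scale c (e * w))"
        by blast
    qed
    show ?thesis
      unfolding bj_orthogonal_def
    proof
      fix c
      have "e * (w + scale c a) = e * w + scale c a"
        by (simp add: distrib_left mult_scale_right ae)
      moreover from this have "w + scale c a - e * (w + scale c a) = w - e * w" by simp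
      moreover have "norm (e * w) \<le> norm (e * w + scale c a)"
        using bj_orthogonalD[OF \<open>bj_orthogonal scale (e * w) a\<close>] .
      ultimately show "norm w \<le> norm (w + scale c a)"
        using split[of w] split[of "w + scale c a"] by simp
    qed
  qed
qed

text \<open>
  For the unit \<open>e\<close> of a skew-field ideal, \<open>a = ew\<close> is left-symmetric and hence orthogonal to \<open>w\<close>. But
  if \<open>a \<noteq> 0\<close>, subtracting a small multiple of \<open>w\<close> from \<open>a\<close> shrinks the part under \<open>e\<close> and
  adds only a small part under the complement.
\<close>

lemma perp_left_symmetric_trivial_if_pseudo_abelian:
  assumes "pseudo_abelian scale"
  shows "set_perp scale (left_symmetric_set scale) \<subseteq> {0}"
proof
  fix w assume w: "w \<in> set_perp scale (left_symmetric_set scale)"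
  have annihilate: "x * w = 0" if I: "minimal_ideal scale I" "is_skew_field I" "x \<in> I" for I x
  proof -
    obtain e where e: "minimal_projection e" "central e" and I_eq: "I = range (\<lambda>x. e * x)"
      using skew_field_ideal_unit I unfolding minimal_ideal_def by blast
    note eD = minimal_projectionD[OF e(1)]
    define a where "a = e * w"
    have ea: "e * a = a" by (simp add: a_def eD)
    have "left_symmetric scale a" using left_symmetric_central_corner[OF e ea] .
    then have "bj_orthogonal scale a w" using w by (simp add: set_perp_iff left_symmetric_set_def)
    have "a = 0"
    proof (rule ccontr)
      assume "a \<noteq> 0"
      define n where "n = norm (w - a)"
      \<comment> \<open>Small enough that the part under the complement stays below \<open>\<parallel>a\<parallel>\<close>.\<close>
      define \<epsilon> where "\<epsilon> = norm a / (2 * (norm a + n))"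
      have pos: "norm a + n > 0" using \<open>a \<noteq> 0\<close> by (simp add: n_def add_pos_nonneg)
      have \<epsilon>: "\<epsilon> > 0" "\<epsilon> < 1" using \<open>a \<noteq> 0\<close> pos by (simp_all add: \<epsilon>_def n_def add_pos_nonneg)
      have "\<epsilon> * n < norm a"
      proof -
        have "\<epsilon> * n \<le> \<epsilon> * (norm a + n)" using \<epsilon> by (intro mult_left_mono) auto
        also have "\<dots> = norm a / 2" using pos by (simp add: \<epsilon>_def field_simps)
        finally have "\<epsilon> * n \<le> norm a / 2" .
        moreover have "norm a > 0" using \<open>a \<noteq> 0\<close> by simp
        ultimately show ?thesis by linarith
      qed
      have "e * (a + (- \<epsilon>) *\<^sub>R w) = (1 - \<epsilon>) *\<^sub>R a"
        by (simp add: right_diff_distrib ea scaleR_diff_left flip: a_def)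
      moreover from this have "a + (- \<epsilon>) *\<^sub>R w - e * (a + (- \<epsilon>) *\<^sub>R w) = (- \<epsilon>) *\<^sub>R (w - a)"
        by (simp add: algebra_simps)
      ultimately have "norm (a + (- \<epsilon>) *\<^sub>R w) = max ((1 - \<epsilon>) * norm a) (\<epsilon> * n)"
        using norm_central_split[OF eD(1) e(2), of "a + (- \<epsilon>) *\<^sub>R w"] \<epsilon> by (simp add: n_def)
      also have "\<dots> < norm a" using \<epsilon> \<open>\<epsilon> * n < norm a\<close> \<open>a \<noteq> 0\<close> by (simp add: algebra_simps)
      finally show False using bj_orthogonal_realD[OF \<open>bj_orthogonal scale a w\<close>, of "- \<epsilon>"] by simp
    qed
    obtain y where "x = e * y" using I(3) I_eq by blast
    then have "x * w = y * (e * w)" using e(2) by (metis central_def mult.assoc)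
    then show ?thesis using \<open>a = 0\<close> by (simp add: a_def)
  qed
  have "x * w = 0" for x
  proof -
    have "x \<in> module.span scale (\<Union>{I. minimal_ideal scale I \<and> is_skew_field I})"
      using assms by (simp add: pseudo_abelian_def)
    then show ?thesis
    proof (induction rule: span_induct_alt)
      case (step c x y)
      then show ?case using annihilate by (auto simp: distrib_right mult_scale_left)
    qed simp
  qed
  then have "star w * w = 0" by blast
  then show "w \<in> {0}" by simp
qed

theorem pseudo_abelian_iff:
  "pseudo_abelian scale \<longleftrightarrow> set_perp scale (set_perp scale (left_symmetric_set scale)) = UNIV"
  unfolding set_perp_set_perp_eq_UNIV_iff
proof
  assume "set_perp scale (left_symmetric_set scale) \<subseteq> {0}"
  then have "central p" if "minimal_projection p" for p
    using noncentral_minimal_projection_in_perp[OF that] minimal_projectionD(2)[OF that] by blast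
  then show "pseudo_abelian scale" by (rule pseudo_abelian_if_minimal_projections_central)
qed (rule perp_left_symmetric_trivial_if_pseudo_abelian)

end

section \<open>Real and complex C*-algebras\<close>

text \<open>
  If \<open>k\<^sup>2 = -e\<close> for a self-adjoint \<open>k\<close>, then \<open>1 + k\<^sup>*k = 1 - e\<close> is annihilated by \<open>e\<close>, so it is
  invertible only if \<open>e = 0\<close>.
\<close>

lemma real_cstar_formally_real_cstar_over:
  assumes "real_cstar_algebra star" and "finite_dim (scaleR :: real \<Rightarrow> 'a::{real_normed_algebra,banach} \<Rightarrow> 'a)"
  shows "formally_real_cstar_over (scaleR :: real \<Rightarrow> 'a \<Rightarrow> 'a) star (\<lambda>r. r)"
proof -
  interpret real_cstar_algebra star by fact
  show ?thesis
  proof unfold_locales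
    fix k e :: 'a
    assume "star k = k" "e * e = e" "e * k = k" "k * k = - e"
    then obtain y where "- e + y + - e * y = 0"
      using one_plus_star_mult_invertible[of k] by auto
    then have "e * (- e + y - e * y) = 0" by simp
    then show "e = 0" using \<open>e * e = e\<close>
      by (simp add: right_diff_distrib distrib_left flip: mult.assoc)
  next
    show "\<exists>B. finite B \<and> span B = (UNIV :: 'a set)"
      using assms(2) by (simp add: finite_dim_def span_raw_def)
  qed (simp_all add: star_star star_add star_scale star_mult cstar_identity)
qed

text \<open>
  If \<open>k\<^sup>2 = -e\<close> for a self-adjoint \<open>k\<close>, then \<open>u = k - ie\<close> satisfies
  \<open>u\<^sup>*u = (k + ie)(k - ie) = k\<^sup>2 + e = 0\<close>. So \<open>k = ie\<close>, which is self-adjoint only if \<open>e = 0\<close>.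
\<close>

lemma complex_cstar_formally_real_cstar_over:
  fixes scale :: "complex \<Rightarrow> 'a::{real_normed_algebra,banach} \<Rightarrow> 'a"
  assumes "complex_cstar_algebra scale star" and "finite_dim scale"
  shows "formally_real_cstar_over scale star cnj"
proof -
  interpret complex_cstar_algebra scale star by fact
  show ?thesis
  proof unfold_locales
    fix k e :: 'a
    assume sa: "star k = k" "star e = e" and ee: "e * e = e" and ek: "e * k = k" "k * e = k"
      and kk: "k * k = - e"
    define u where "u = k - scale \<i> e"
    have "u = k + scale (- \<i>) e" by (simp add: u_def)
    then have "star u = k + scale \<i> e" by (simp only: star_add star_scale sa) simp
    then have "star u * u = 0"
      by (simp add: u_def algebra_simps mult_scale_left mult_scale_right ek ee kk)
    then have "u = 0" using cstar_identity[of u] by simp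
    then have "k = scale \<i> e" "k = scale (- \<i>) e"
      using star_scale[of \<i> e] sa by (auto simp: u_def)
    then have "scale (\<i> - - \<i>) e = 0" by (simp only: scale_left_diff_distrib) simp
    then show "e = 0" by (simp only: scale_eq_0_iff) simp
  next
    obtain B where B: "finite B" "module.span scale B = UNIV"
      using assms(2) by (auto simp: finite_dim_def)
    let ?C = "B \<union> scale \<i> ` B"
    \<comment> \<open>The real span of \<open>B\<close> and \<open>iB\<close> is closed under \<open>i\<close>, hence is the complex span of \<open>B\<close>.\<close>
    have i_closed: "scale \<i> x \<in> Real_Vector_Spaces.span ?C" if "x \<in> Real_Vector_Spaces.span ?C" for x
      using that
    proof (induction rule: real_vector.span_induct_alt)
      case base
      then show ?case by (simp add: real_vector.span_zero)
    next
      case (step c x y)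
      have "scale \<i> x \<in> Real_Vector_Spaces.span ?C"
      proof (cases "x \<in> B")
        case False
        then obtain b where "b \<in> B" "x = scale \<i> b" using step by blast
        then have "scale \<i> x = - b" by simp
        then show ?thesis using \<open>b \<in> B\<close> by (simp add: real_vector.span_neg real_vector.span_base)
      qed (simp add: real_vector.span_base)
      moreover have "scale \<i> (c *\<^sub>R x + y) = c *\<^sub>R scale \<i> x + scale \<i> y"
        by (simp add: scale_right_distrib mult.commute flip: scale_of_real)
      ultimately show ?case using step by (simp add: real_vector.span_add real_vector.span_scale)
    qed
    have "x \<in> Real_Vector_Spaces.span ?C" for x
    proof -
      have "x \<in> module.span scale B" using B by simp
      then show ?thesis
      proof (induction rule: span_induct_alt)
        case base
        then show ?case by (simp add: real_vector.span_zero)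
      next
        case (step c x y)
        have x: "x \<in> Real_Vector_Spaces.span ?C" using step by (simp add: real_vector.span_base)
        have "scale c x = Re c *\<^sub>R x + Im c *\<^sub>R scale \<i> x"
          by (simp add: complex_eq_iff flip: scale_of_real scale_left_distrib)
        then show ?case
          using x i_closed[OF x] step by (simp add: real_vector.span_add real_vector.span_scale)
      qed
    qed
    then show "\<exists>B. finite B \<and> Real_Vector_Spaces.span B = (UNIV :: 'a set)"
      using B by (intro exI[of _ ?C]) auto
  next
    show "star (r *\<^sub>R x) = r *\<^sub>R star x" for r x
      using star_scale[of "of_real r" x] by (simp add: scale_of_real)
  qed (simp_all add: star_star star_add star_scale star_mult cstar_identity)
qed

theorem corollary1p3:
  fixes star\<^sub>R :: "'a::{real_normed_algebra,banach} \<Rightarrow> 'a"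
    and scale\<^sub>C :: "complex \<Rightarrow> 'b::{real_normed_algebra,banach} \<Rightarrow> 'b"
    and star\<^sub>C :: "'b \<Rightarrow> 'b"
  shows
    "(real_cstar_algebra star\<^sub>R \<and> finite_dim (scaleR :: real \<Rightarrow> 'a \<Rightarrow> 'a) \<longrightarrow>
       (pseudo_abelian (scaleR :: real \<Rightarrow> 'a \<Rightarrow> 'a) \<longleftrightarrow>
        set_perp scaleR (set_perp scaleR (left_symmetric_set scaleR)) = (UNIV :: 'a set))) \<and>
     (complex_cstar_algebra scale\<^sub>C star\<^sub>C \<and> finite_dim scale\<^sub>C \<longrightarrow>
       (pseudo_abelian scale\<^sub>C \<longleftrightarrow>
        set_perp scale\<^sub>C (set_perp scale\<^sub>C (left_symmetric_set scale\<^sub>C)) = UNIV))"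
proof (intro conjI impI; elim conjE)
  assume "real_cstar_algebra star\<^sub>R" and "finite_dim (scaleR :: real \<Rightarrow> 'a \<Rightarrow> 'a)"
  then show "pseudo_abelian (scaleR :: real \<Rightarrow> 'a \<Rightarrow> 'a) \<longleftrightarrow>
      set_perp scaleR (set_perp scaleR (left_symmetric_set scaleR)) = (UNIV :: 'a set)"
    by (rule formally_real_cstar_over.pseudo_abelian_iff[OF real_cstar_formally_real_cstar_over])
next
  assume "complex_cstar_algebra scale\<^sub>C star\<^sub>C" and "finite_dim scale\<^sub>C"
  then show "pseudo_abelian scale\<^sub>C \<longleftrightarrow>
      set_perp scale\<^sub>C (set_perp scale\<^sub>C (left_symmetric_set scale\<^sub>C)) = UNIV"
    by (rule formally_real_cstar_over.pseudo_abelian_iff[OF complex_cstar_formally_real_cstar_over])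
qed

end
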